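(* Let $A_c\in\mathbb{R}^{n\times n}$ and $B_c\in\mathbb{R}^{n\times m}$, let $\bm{\Sigma}_c:\ \dot x_c(t)=A_cx_c(t)+B_cu_c(t)$, let $\tau\in\mathbb{R}_{>0}$ be a sampling time and $N\ge 1$ an integer. There exist matrices $A_d\in\mathbb{R}^{n\times n}$ and $B_d\in\mathbb{R}^{n\times m}$ such that $\bm{\Sigma}_c$ is an $N$-th order interpolator of $\bm{\Sigma}_d:\ x_d(i+1)=A_dx_d(i)+B_du_d(i)$ with respect to the sampling time $\tau$ if and only if there exist (real) vectors $v_1$ and $v_2$ (of dimensions $(nN+mN)(n+2m)$ and $n(n+m)$, respectively) such that $$\begin{bmatrix} I\otimes Q_N^\tau(A_c,B_c) & -T_2^\top\otimes T_1\end{bmatrix}\begin{bmatrix}v_1\\ v_2\end{bmatrix}=\operatorname{vec}\big(R_N^\tau(A_c,B_c)\big).$$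
   Context: For integers $k_1\le k_2$, $\llbracket k_1,k_2\rrbracket=\{k\in\mathbb{Z}: k_1\le k\le k_2\}$. $x_c(t;x_0,u_c)$ denotes the solution at time $t$ of $\dot x_c=A_cx_c+B_cu_c$ with $x_c(0)=x_0$ and input $u_c$; $x_d(i;x_0,u_d)$ denotes the solution at step $i$ of $x_d(i+1)=A_dx_d(i)+B_du_d(i)$ with $x_d(0)=x_0$ and input $u_d$. $f|_{I'}$ denotes restriction to $I'$. $\mathbb{P}_N^p$ is the space of $\mathbb{R}^p$-valued polynomials of degree at most $N$. Signal interpolation: for $\ell,p\in\mathbb{Z}_{>0}$ and $s_d:\llbracket 0,\ell\rrbracket\to\mathbb{R}^p$, a function $s_c:[0,\ell\tau]\to\mathbb{R}^p$ is an $N$-th order interpolation of $s_d$ with respect to the sampling time $\tau$ if there exist $P_0,\dots,P_{\ell-1}\in\mathbb{P}_N^p|_{[0,\tau]}$ such that for all $i\in\llbracket 0,\ell-1\rrbracket$: $s_c(i\tau)=s_d(i)$, $s_c((i+1)\tau)=s_d(i+1)$, and $s_c(i\tau+t)=P_i(t)$ for all $t\in[0,\tau]$. The set of all such $s_c$ is denoted $\mathbb{I}_N^\tau(s_d)$. System interpolation: $\bm{\Sigma}_c$ is an $N$-th order interpolator of $\bm{\Sigma}_d$ with respect to the sampling time $\tau$ if for any $\ell\in\mathbb{Z}_{>0}$, any $x_0\in\mathbb{R}^n$ and any $u_d:\llbracket 0,\ell\rrbracket\to\mathbb{R}^m$, there exists $u_c\in\mathbb{I}_N^\tau(u_d)$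 such that $x_c(\cdot;x_0,u_c)|_{[0,\ell\tau]}\in\mathbb{I}_N^\tau\big(x_d(\cdot;x_0,u_d)|_{\llbracket 0,\ell\rrbracket}\big)$. Quadrature nodes: let $\mathfrak{L}_k(t)=\frac{1}{2^k}\sum_{i=0}^{\lfloor k/2\rfloor}(-1)^i\binom{k}{i}\binom{2k-2i}{k}t^{k-2i}$ be the standard Legendre polynomial of degree $k$, and $\mathfrak{L}_k^\tau(t)=\mathfrak{L}_k(2t/\tau-1)$ the shifted one. The nodes $t_{N,0}<t_{N,1}<\dots<t_{N,N}$ are the $N+1$ distinct (real) zeros of $\mathfrak{L}_N^\tau+\mathfrak{L}_{N+1}^\tau$; they satisfy $t_{N,0}=0$ and $t_{N,N}<\tau$. For $i=0,\dots,N$ let $\phi_i(t)=\prod_{j=0,j\ne i}^{N}\frac{t-t_{N,j}}{t_{N,i}-t_{N,j}}$, with derivative $\dot\phi_i$. Define $\Phi=(\phi_1(\tau),\dots,\phi_N(\tau))^\top\in\mathbb{R}^N$; $\psi_j=(\dot\phi_1(t_{N,j}),\dots,\dot\phi_N(t_{N,j}))^\top\in\mathbb{R}^N$ for $j=0,\dots,N$; $\Psi=[\psi_1\ \psi_2\ \cdots\ \psi_N]\in\mathbb{R}^{N\times N}$; $\sigma=[\dot\phi_0(t_{N,1})\ \cdots\ \dot\phi_0(t_{N,N})]\in\mathbb{R}^{1\times N}$. $\otimes$ is the Kronecker product, $N_1\oplus M_1=N_1\otimes I+I\otimes M_1$ is the Kronecker sum of square matrices (so $\Psi^\top\oplus(-A_c)=\Psi^\top\otimes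 I_n-I_N\otimes A_c$), $\operatorname{vec}$ is column-stacking vectorization, and $I$, $0$ are identity and zero matrices of appropriate size. Define $$Q_N^\tau(A_c,B_c)=\begin{bmatrix}\psi_0^\top\otimes I & 0\\ \Psi^\top\oplus(-A_c) & -I\otimes B_c\\ \Phi^\top\otimes I & 0\\ 0 & \Phi^\top\otimes I\end{bmatrix},\qquad R_N^\tau(A_c,B_c)=\begin{bmatrix} A_c-\dot\phi_0(0)I & B_c & 0\\ -\sigma^\top\otimes I & 0 & 0\\ -\phi_0(\tau)I & 0 & 0\\ 0 & -\phi_0(\tau)I & I\end{bmatrix},$$ $$T_1=\begin{bmatrix} 0 \\ 0 \\ I \\ 0 \end{bmatrix},\qquad T_2=\begin{bmatrix} I & 0 & 0 \\ 0 & I & 0 \end{bmatrix}.$$ The block rows of $Q_N^\tau$, $R_N^\tau$ and $T_1$ have $n$, $nN$, $n$, $m$ rows; the block columns of $Q_N^\tau$ have $nN,mN$ columns, those of $R_N^\tau$ and $T_2$ have $n,m,m$ columns; $T_1$ has $n$ columns and $T_2$ has block rows of $n$ and $m$ rows. In $I\otimes Q_N^\tau(A_c,B_c)$ the identity is of size $n+2m$. *)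

theory Defs
  imports Complex_Main "Jordan_Normal_Form.Matrix" "HOL-Computational_Algebra.Polynomial"
begin

definition vec_polys :: "nat \<Rightarrow> nat \<Rightarrow> (real \<Rightarrow> real vec) set" where
  "vec_polys N p = {P. \<exists>q :: nat \<Rightarrow> real poly. (\<forall>k<p. degree (q k) \<le> N) \<and>
     (\<forall>t. P t = vec p (\<lambda>k. poly (q k) t))}"

text \<open>
  Signals on \<open>[0, l \<tau>]\<close> and on \<open>{0..l}\<close> are represented by total functions; every condition below
  only concerns their values on these domains, so the restrictions of signals stay implicit.
\<close>

definition interpolations ::
  "nat \<Rightarrow> real \<Rightarrow> nat \<Rightarrow> nat \<Rightarrow> (nat \<Rightarrow> real vec) \<Rightarrow> (real \<Rightarrow> real vec) set" where
  "interpolations N \<tau> p l sd = {sc. \<exists>P :: nat \<Rightarrow> real \<Rightarrow> real vec. \<forall>i<l.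
     P i \<in> vec_polys N p \<and>
     sc (real i * \<tau>) = sd i \<and> sc (real (i + 1) * \<tau>) = sd (i + 1) \<and>
     (\<forall>t\<in>{0..\<tau>}. sc (real i * \<tau> + t) = P i t)}"

text \<open>
  There is no topology on \<open>real vec\<close>, so the differential equation is read componentwise; the
  derivative is one-sided at the end points of \<open>[0, T]\<close>.
\<close>

definition ct_solution ::
  "real mat \<Rightarrow> real mat \<Rightarrow> real \<Rightarrow> real vec \<Rightarrow> (real \<Rightarrow> real vec) \<Rightarrow> (real \<Rightarrow> real vec) \<Rightarrow> bool" where
  "ct_solution A B T x0 u x \<longleftrightarrow> x 0 = x0 \<and>
     (\<forall>t\<in>{0..T}. x t \<in> carrier_vec (dim_row A) \<and>
       (\<forall>k<dim_row A. ((\<lambda>s. x s $ k) has_real_derivative (A *\<^sub>v x t + B *\<^sub>v u t) $ k)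
          (at t within {0..T})))"

primrec dt_solution ::
  "real mat \<Rightarrow> real mat \<Rightarrow> real vec \<Rightarrow> (nat \<Rightarrow> real vec) \<Rightarrow> nat \<Rightarrow> real vec" where
  "dt_solution A B x0 u 0 = x0"
| "dt_solution A B x0 u (Suc i) = A *\<^sub>v dt_solution A B x0 u i + B *\<^sub>v u i"

text \<open>
  An input \<open>uc\<close> interpolating \<open>ud\<close> is continuous on \<open>[0, l \<tau>]\<close>, so the solution \<open>xc\<close> below exists
  and is unique on that interval.
\<close>

definition system_interpolator ::
  "nat \<Rightarrow> real \<Rightarrow> real mat \<Rightarrow> real mat \<Rightarrow> real mat \<Rightarrow> real mat \<Rightarrow> bool" where
  "system_interpolator N \<tau> Ac Bc Ad Bd \<longleftrightarrow>
     (let n = dim_row Ac; m = dim_col Bc in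
      \<forall>l>0. \<forall>x0\<in>carrier_vec n. \<forall>ud. (\<forall>i\<le>l. ud i \<in> carrier_vec m) \<longrightarrow>
        (\<exists>uc\<in>interpolations N \<tau> m l ud.
         \<exists>xc. ct_solution Ac Bc (real l * \<tau>) x0 uc xc \<and>
              xc \<in> interpolations N \<tau> n l (dt_solution Ad Bd x0 ud)))"

definition legendre :: "nat \<Rightarrow> real poly" where
  "legendre k = smult (1 / 2 ^ k) (\<Sum>i\<le>k div 2.
     monom ((-1) ^ i * real (k choose i) * real ((2 * k - 2 * i) choose k)) (k - 2 * i))"

definition shifted_legendre :: "real \<Rightarrow> nat \<Rightarrow> real poly" where
  "shifted_legendre \<tau> k = pcompose (legendre k) [:-1, 2 / \<tau>:]"

definition node :: "nat \<Rightarrow> real \<Rightarrow> nat \<Rightarrow> real" where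
  "node N \<tau> i =
     sorted_list_of_set {t. poly (shifted_legendre \<tau> N + shifted_legendre \<tau> (N + 1)) t = 0} ! i"

definition lagrange :: "nat \<Rightarrow> real \<Rightarrow> nat \<Rightarrow> real poly" where
  "lagrange N \<tau> i = (\<Prod>j\<in>{0..N} - {i}.
     smult (1 / (node N \<tau> i - node N \<tau> j)) [:- node N \<tau> j, 1:])"

definition Phi :: "nat \<Rightarrow> real \<Rightarrow> real vec" where
  "Phi N \<tau> = vec N (\<lambda>i. poly (lagrange N \<tau> (i + 1)) \<tau>)"

definition psi :: "nat \<Rightarrow> real \<Rightarrow> nat \<Rightarrow> real vec" where
  "psi N \<tau> j = vec N (\<lambda>i. poly (pderiv (lagrange N \<tau> (i + 1))) (node N \<tau> j))"

definition Psi :: "nat \<Rightarrow> real \<Rightarrow> real mat" where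
  "Psi N \<tau> = mat_of_cols N (map (psi N \<tau>) [1..<N + 1])"

definition sigma :: "nat \<Rightarrow> real \<Rightarrow> real mat" where
  "sigma N \<tau> = mat 1 N (\<lambda>(_, j). poly (pderiv (lagrange N \<tau> 0)) (node N \<tau> (j + 1)))"

definition kron :: "real mat \<Rightarrow> real mat \<Rightarrow> real mat" (infixl \<open>\<otimes>\<^sub>k\<close> 70) where
  "A \<otimes>\<^sub>k B = mat (dim_row A * dim_row B) (dim_col A * dim_col B)
     (\<lambda>(i, j). A $$ (i div dim_row B, j div dim_col B) * B $$ (i mod dim_row B, j mod dim_col B))"

definition kron_sum :: "real mat \<Rightarrow> real mat \<Rightarrow> real mat" (infixl \<open>\<oplus>\<^sub>k\<close> 65) where
  "A \<oplus>\<^sub>k B = A \<otimes>\<^sub>k 1\<^sub>m (dim_row B) + 1\<^sub>m (dim_row A) \<otimes>\<^sub>k B"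

definition stack_cols :: "real mat \<Rightarrow> real vec" where
  "stack_cols A = vec (dim_row A * dim_col A) (\<lambda>k. A $$ (k mod dim_row A, k div dim_row A))"

definition append_cols :: "real mat \<Rightarrow> real mat \<Rightarrow> real mat" (infixr \<open>@\<^sub>c\<close> 66) where
  "A @\<^sub>c B = four_block_mat A B (0\<^sub>m 0 (dim_col A)) (0\<^sub>m 0 (dim_col B))"

text \<open>\<open>@\<^sub>c\<close> binds tighter than \<open>@\<^sub>r\<close>, so a block matrix is written as its block rows joined by \<open>@\<^sub>r\<close>.\<close>

definition Q_mat :: "nat \<Rightarrow> real \<Rightarrow> real mat \<Rightarrow> real mat \<Rightarrow> real mat" where
  "Q_mat N \<tau> Ac Bc = (let n = dim_row Ac; m = dim_col Bc in
     (mat_of_row (psi N \<tau> 0) \<otimes>\<^sub>k 1\<^sub>m n)     @\<^sub>c 0\<^sub>m n (m * N) @\<^sub>r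
     ((Psi N \<tau>)\<^sup>T \<oplus>\<^sub>k (- Ac))             @\<^sub>c (- (1\<^sub>m N \<otimes>\<^sub>k Bc)) @\<^sub>r
     (mat_of_row (Phi N \<tau>) \<otimes>\<^sub>k 1\<^sub>m n)       @\<^sub>c 0\<^sub>m n (m * N) @\<^sub>r
     0\<^sub>m m (n * N)                          @\<^sub>c (mat_of_row (Phi N \<tau>) \<otimes>\<^sub>k 1\<^sub>m m))"

definition R_mat :: "nat \<Rightarrow> real \<Rightarrow> real mat \<Rightarrow> real mat \<Rightarrow> real mat" where
  "R_mat N \<tau> Ac Bc = (let n = dim_row Ac; m = dim_col Bc; \<phi>0 = lagrange N \<tau> 0 in
     (Ac - poly (pderiv \<phi>0) 0 \<cdot>\<^sub>m 1\<^sub>m n)    @\<^sub>c Bc                       @\<^sub>c 0\<^sub>m n m @\<^sub>r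
     (- ((sigma N \<tau>)\<^sup>T) \<otimes>\<^sub>k 1\<^sub>m n)          @\<^sub>c 0\<^sub>m (n * N) m             @\<^sub>c 0\<^sub>m (n * N) m @\<^sub>r
     (- poly \<phi>0 \<tau> \<cdot>\<^sub>m 1\<^sub>m n)               @\<^sub>c 0\<^sub>m n m                   @\<^sub>c 0\<^sub>m n m @\<^sub>r
     0\<^sub>m m n                              @\<^sub>c (- poly \<phi>0 \<tau> \<cdot>\<^sub>m 1\<^sub>m m)    @\<^sub>c 1\<^sub>m m)"

definition T1_mat :: "nat \<Rightarrow> nat \<Rightarrow> nat \<Rightarrow> real mat" where
  "T1_mat N n m = 0\<^sub>m n n @\<^sub>r 0\<^sub>m (n * N) n @\<^sub>r 1\<^sub>m n @\<^sub>r 0\<^sub>m m n"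

definition T2_mat :: "nat \<Rightarrow> nat \<Rightarrow> real mat" where
  "T2_mat n m =
     1\<^sub>m n   @\<^sub>c 0\<^sub>m n m @\<^sub>c 0\<^sub>m n m @\<^sub>r
     0\<^sub>m m n @\<^sub>c 1\<^sub>m m   @\<^sub>c 0\<^sub>m m m"

end

theory Submission
  imports Defs
begin

text \<open>
  By Rodrigues' formula \<open>L\<^sub>N + L\<^sub>N\<^sub>+\<^sub>1\<close> is a multiple of the \<open>N\<close>-th derivative of
  \<open>(t - 1)\<^sup>N (t + 1)\<^sup>N\<^sup>+\<^sup>1\<close>, so Rolle's theorem yields \<open>N + 1\<close> distinct zeros, the least being \<open>-1\<close>;
  hence the nodes are distinct and \<open>t\<^sub>0 = 0\<close>. If \<open>x\<close> and \<open>u\<close> are polynomials of degree at most \<open>N\<close>,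
  then so is \<open>x' - A x - B u\<close>, which therefore vanishes iff it vanishes at the \<open>N + 1\<close> nodes. Expanding
  \<open>x\<close> and \<open>u\<close> in the Lagrange basis turns the existence of a polynomial solution on one sampling
  interval with prescribed \<open>x(0)\<close>, \<open>u(0)\<close>, \<open>u(\<tau>)\<close> and \<open>x(\<tau>) = A\<^sub>d x(0) + B\<^sub>d u(0)\<close> into
  \<open>Q w = (R + T\<^sub>1 [A\<^sub>d B\<^sub>d] T\<^sub>2) z\<close> with \<open>z\<close> the prescribed data. Solvability for all \<open>z\<close> means
  \<open>Q V = R + T\<^sub>1 [A\<^sub>d B\<^sub>d] T\<^sub>2\<close> for some matrix \<open>V\<close>, and vectorizing this gives the linear system.
  One interval suffices, because solutions on successive intervals can be glued.
\<close>

subsection \<open>Quadrature nodes\<close>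

lemma smult_sum_right: "smult c (sum f A) = (\<Sum>x\<in>A. smult c (f x))" for c :: real
  by (induction A rule: infinite_finite_induct) (simp_all add: smult_add_right)

text \<open>The falling factorial j!/(j-k)! is split as \<open>fact k\<close> times a binomial
  coefficient, so that \<open>fact k\<close> cancels against the normalization in Rodrigues' formula
  and the binomial of \<open>legendre\<close> remains.\<close>

lemma higher_pderiv_monom_real:
  assumes "k \<le> j"
  shows "(pderiv ^^ k) (monom c j) = monom (fact k * real (j choose k) * c) (j - k)"
proof (rule poly_eqI)
  fix i
  have "fact j = (pochhammer 1 ((j - k) + k) :: real)"
    using assms by (simp add: pochhammer_fact)
  also have "\<dots> = fact (j - k) * pochhammer (real (Suc (j - k))) k"
    by (subst pochhammer_product') (simp add: pochhammer_fact)
  finally have "pochhammer (real (Suc (j - k))) k = fact k * real (j choose k)"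
    using binomial_fact[OF assms, where 'a=real] by (simp add: divide_simps mult.commute)
  then show "coeff ((pderiv ^^ k) (monom c j)) i = coeff (monom (fact k * real (j choose k) * c) (j - k)) i"
    using assms by (auto simp: coeff_higher_pderiv)
qed

text \<open>Expand (t^2 - 1)^k binomially and differentiate term by term. A term with i > k div 2
  has degree 2k - 2i < k and disappears, which is the truncation in \<open>legendre\<close>.\<close>

lemma legendre_rodrigues:
  "legendre k = smult (1 / (2 ^ k * fact k)) ((pderiv ^^ k) ([:-1, 0, 1:] ^ k))"
proof -
  have w: "[:-1, 0, 1::real:] = monom 1 2 + monom (-1) 0"
    by (simp add: monom_altdef numeral_2_eq_2)
  \<comment> \<open>Exchanging the summands puts the exponent \<open>i\<close> on the constant -1,
    which produces the sign of the Legendre coefficients.\<close>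
  have "[:-1, 0, 1::real:] ^ k
      = (\<Sum>i\<le>k. of_nat (k choose i) * monom (-1) 0 ^ i * monom 1 2 ^ (k - i))"
    unfolding w by (subst add.commute, subst binomial_ring) simp
  also have "\<dots> = (\<Sum>i\<le>k. monom ((-1) ^ i * real (k choose i)) (2 * k - 2 * i))"
    by (intro sum.cong refl)
      (simp add: monom_power mult_monom of_nat_monom diff_mult_distrib diff_mult_distrib2 mult.commute)
  finally have expand: "[:-1, 0, 1::real:] ^ k
      = (\<Sum>i\<le>k. monom ((-1) ^ i * real (k choose i)) (2 * k - 2 * i))" .
  have upper: "(pderiv ^^ k) (monom ((-1) ^ i * real (k choose i)) (2 * k - 2 * i)) = 0"
    if "k div 2 < i" "i \<le> k" for i
  proof (rule poly_eqI)
    fix j show "coeff ((pderiv ^^ k) (monom ((-1) ^ i * real (k choose i)) (2 * k - 2 * i))) j = coeff 0 j"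
      using that by (simp add: coeff_higher_pderiv)
  qed
  have lower: "smult (1 / (2 ^ k * fact k)) ((pderiv ^^ k) (monom ((-1) ^ i * real (k choose i)) (2 * k - 2 * i)))
     = smult (1 / 2 ^ k) (monom ((-1) ^ i * real (k choose i) * real ((2 * k - 2 * i) choose k)) (k - 2 * i))"
    if "i \<le> k div 2" for i
  proof -
    have le: "k \<le> 2 * k - 2 * i" using that by linarith
    have eq: "2 * k - 2 * i - k = k - 2 * i" by simp
    show ?thesis
      by (simp add: higher_pderiv_monom_real[OF le] eq smult_monom)
  qed
  have "smult (1 / (2 ^ k * fact k)) ((pderiv ^^ k) ([:-1, 0, 1:] ^ k))
     = (\<Sum>i\<le>k. smult (1 / (2 ^ k * fact k))
         ((pderiv ^^ k) (monom ((-1) ^ i * real (k choose i)) (2 * k - 2 * i))))"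
    unfolding expand by (simp add: higher_pderiv_sum smult_sum_right)
  also have "\<dots> = (\<Sum>i\<le>k div 2. smult (1 / (2 ^ k * fact k))
         ((pderiv ^^ k) (monom ((-1) ^ i * real (k choose i)) (2 * k - 2 * i))))"
    by (rule sum.mono_neutral_right) (auto simp: upper)
  also have "\<dots> = legendre k"
    unfolding legendre_def smult_sum_right by (intro sum.cong refl lower) simp
  finally show ?thesis ..
qed

lemma higher_pderiv_Suc: "(pderiv ^^ Suc k) p = (pderiv ^^ k) (pderiv p)"
  by (simp only: funpow_Suc_right o_apply)

text \<open>One derivative of (t^2 - 1)^(k+1) is 2(k+1) t (t^2 - 1)^k, so both Legendre polynomials
  become k-th derivatives with the same scalar factor. Their sum gathers the factor 1 + t, and (1 +
  t)(t^2 - 1)^k = (t - 1)^k (t + 1)^(k+1).\<close>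

lemma legendre_add_Suc:
  "legendre k + legendre (Suc k)
     = smult (1 / (2 ^ k * fact k)) ((pderiv ^^ k) ([:-1, 1:] ^ k * [:1, 1:] ^ Suc k))"
proof -
  let ?w = "[:-1, 0, 1::real:]"
  have d: "pderiv (?w ^ Suc k) = smult (2 * real (Suc k)) ([:0, 1:] * ?w ^ k)"
    by (simp only: pderiv_power_Suc) (simp add: pderiv_pCons)
  have "legendre (Suc k) = smult (1 / (2 ^ Suc k * fact (Suc k)))
      ((pderiv ^^ k) (smult (2 * real (Suc k)) ([:0, 1:] * ?w ^ k)))"
    by (simp only: legendre_rodrigues higher_pderiv_Suc d)
  also have "\<dots> = smult (1 / (2 ^ k * fact k)) ((pderiv ^^ k) ([:0, 1:] * ?w ^ k))"
    by (simp only: higher_pderiv_smult smult_smult) (simp add: divide_simps del: of_nat_Suc)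
  finally have "legendre k + legendre (Suc k)
      = smult (1 / (2 ^ k * fact k)) ((pderiv ^^ k) (?w ^ k + [:0, 1:] * ?w ^ k))"
    by (simp only: legendre_rodrigues[of k] higher_pderiv_add smult_add_right)
  also have "?w ^ k + [:0, 1:] * ?w ^ k = [:1, 1:] * ?w ^ k"
    by (simp add: algebra_simps)
  also have "?w = [:-1, 1:] * [:1, 1:]" by simp
  also have "[:1, 1:] * ([:-1, 1:] * [:1, 1:]) ^ k = [:-1, 1:] ^ k * [:1, 1::real:] ^ Suc k"
    by (simp only: power_mult_distrib power_Suc mult.assoc mult.left_commute)
  finally show ?thesis .
qed

section \<open>Zeros of the sum of two consecutive Legendre polynomials\<close>

lemma power_dvd_pderiv:
  assumes "p ^ Suc k dvd q"
  shows "p ^ k dvd pderiv (q :: real poly)"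
proof -
  from assms obtain r where "q = p ^ Suc k * r" by (auto elim: dvdE)
  then have "pderiv q = p ^ k * (p * pderiv r + smult (real (Suc k)) (pderiv p * r))"
    by (simp only: pderiv_mult pderiv_power_Suc) (simp add: algebra_simps)
  then show ?thesis by simp
qed

text \<open>Orders of vanishing are tracked as divisibility by powers of linear factors, which
  avoids exact multiplicities.\<close>

lemma power_dvd_higher_pderiv:
  "p ^ (k + j) dvd q \<Longrightarrow> p ^ k dvd (pderiv ^^ j) (q :: real poly)"
proof (induction j arbitrary: q)
  case (Suc j)
  have "p ^ (k + j) dvd pderiv q" by (rule power_dvd_pderiv) (use Suc.prems in simp)
  then show ?case by (simp only: higher_pderiv_Suc Suc.IH)
qed simp

lemma rolle_poly:
  fixes p :: "real poly"
  assumes "a < b" "poly p a = 0" "poly p b = 0"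
  obtains c where "a < c" "c < b" "poly (pderiv p) c = 0"
  using poly_MVT[OF assms(1), of p] assms by auto

text \<open>Each differentiation costs one order of vanishing at \<open>\<pm>1\<close> and, by Rolle, gains one interior zero.\<close>

lemma higher_pderiv_zeros:
  assumes "j \<le> k"
  shows "\<exists>z :: nat \<Rightarrow> real. z 0 = -1 \<and> z (Suc j) = 1 \<and> (\<forall>i\<le>j. z i < z (Suc i)) \<and>
    (\<forall>i\<le>j. poly ((pderiv ^^ j) ([:-1, 1:] ^ k * [:1, 1:] ^ Suc k)) (z i) = 0)"
  using assms
proof (induction j)
  case 0
  \<comment> \<open>Only -1 is asserted to be a zero here; the point 1 merely closes the list of
    intervals, since for k = 0 it is no zero.\<close>
  show ?case by (rule exI[of _ "\<lambda>i. if i = 0 then -1 else 1"]) simp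
next
  case (Suc j)
  let ?p = "[:-1, 1:] ^ k * [:1, 1::real:] ^ Suc k"
  let ?P = "(pderiv ^^ j) ?p"
  obtain z where z: "z 0 = -1" "z (Suc j) = 1" "\<And>i. i \<le> j \<Longrightarrow> z i < z (Suc i)"
    "\<And>i. i \<le> j \<Longrightarrow> poly ?P (z i) = 0"
    using Suc by auto
  \<comment> \<open>Since j < k, the factor (t - 1)^k still leaves a zero at 1, so Rolle also
    applies to the last interval, between \<open>z j\<close> and 1.\<close>
  have "[:-1, 1:] ^ (1 + j) dvd ?p"
    by (rule dvd_mult2, rule le_imp_power_dvd) (use Suc.prems in simp)
  from power_dvd_higher_pderiv[OF this] have "poly ?P 1 = 0"
    by (simp add: poly_eq_0_iff_dvd)
  then have z': "poly ?P (z i) = 0" if "i \<le> Suc j" for i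
    using z that by (cases "i = Suc j") auto
  have "\<exists>c. z i < c \<and> c < z (Suc i) \<and> poly (pderiv ?P) c = 0" if "i \<le> j" for i
    by (rule rolle_poly[OF z(3)[OF that] z' z']) (use that in auto)
  then obtain c where c: "\<And>i. i \<le> j \<Longrightarrow> z i < c i \<and> c i < z (Suc i) \<and> poly (pderiv ?P) (c i) = 0"
    by metis
  \<comment> \<open>The Rolle points move up by one index to make room for -1 at the front, and 1
    again closes the list.\<close>
  define z2 where "z2 = (\<lambda>i. if i = 0 then -1 else if i = Suc (Suc j) then 1 else c (i - 1))"
  \<comment> \<open>The exponent at -1 is k + 1, one more than at 1, so -1 stays a zero of all
    derivatives up to order k.\<close>
  have "[:1, 1:] ^ (1 + Suc j) dvd ?p"
    by (rule dvd_mult, rule le_imp_power_dvd) (use Suc.prems in simp)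
  from power_dvd_higher_pderiv[OF this] have "poly ((pderiv ^^ Suc j) ?p) (-1) = 0"
    by (simp only: poly_eq_0_iff_dvd power_one_right minus_minus)
  then have "poly ((pderiv ^^ Suc j) ?p) (z2 i) = 0" if "i \<le> Suc j" for i
    using that c[of "i - 1"] by (auto simp: z2_def)
  moreover have "z2 i < z2 (Suc i)" if "i \<le> Suc j" for i
  proof (cases i)
    case 0
    then show ?thesis using c[of 0] z(1) by (simp add: z2_def)
  next
    case (Suc i')
    with that c[of i'] c[of i] z(2) show ?thesis
      by (cases "i = Suc j") (auto simp: z2_def)
  qed
  ultimately show ?case
    by (intro exI[of _ z2]) (auto simp: z2_def)
qed


lemma less_if_less_Suc:
  fixes z :: "nat \<Rightarrow> real"
  assumes "\<And>i. i \<le> j \<Longrightarrow> z i < z (Suc i)" "a < b" "b \<le> Suc j"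
  shows "z a < z b"
  using assms(2,3)
proof (induction b)
  case (Suc b)
  then show ?case using assms(1)[of b] by (cases "a = b") force+
qed simp

text \<open>The degree is 2k + 1 - k = k + 1, while \<open>higher_pderiv_zeros\<close> with j = k
  supplies k + 1 increasing zeros starting at -1. These are therefore all the zeros, and -1 is the
  least.\<close>

lemma legendre_add_Suc_roots:
  fixes k :: nat
  defines "S \<equiv> {t. poly (legendre k + legendre (Suc k)) t = 0}"
  shows "finite S" "card S = Suc k" "-1 \<in> S" "\<And>t. t \<in> S \<Longrightarrow> -1 \<le> t"
proof -
  let ?p = "[:-1, 1:] ^ k * [:1, 1::real:] ^ Suc k"
  let ?P = "(pderiv ^^ k) ?p"
  have S: "S = {t. poly ?P t = 0}"
    unfolding S_def legendre_add_Suc by simp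
  have "degree ?p = degree ([:-1, 1::real:] ^ k) + degree ([:1, 1::real:] ^ Suc k)"
    by (rule degree_mult_eq) (simp_all del: power_Suc)
  also have "\<dots> = 2 * k + 1" by (simp only: degree_linear_power)
  finally have deg: "degree ?P = Suc k"
    by (simp only: degree_higher_pderiv)
  then have "?P \<noteq> 0" by (metis degree_0 nat.distinct(1))
  then have fin: "finite S" and le: "card S \<le> Suc k"
    unfolding S using poly_roots_finite card_poly_roots_bound deg by metis+
  obtain z where z: "z 0 = -1" "\<And>i. i \<le> k \<Longrightarrow> z i < z (Suc i)" "\<And>i. i \<le> k \<Longrightarrow> poly ?P (z i) = 0"
    using higher_pderiv_zeros[of k k] by auto
  have less: "z a < z b" if "a < b" "b \<le> k" for a b
    using less_if_less_Suc[of k z a b] z(2) that by simp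
  have "inj_on z {..k}"
    using less by (intro inj_onI) (metis atMost_iff less_irrefl linorder_neqE_nat)
  then have "card (z ` {..k}) = Suc k" by (simp add: card_image)
  moreover have "z ` {..k} \<subseteq> S" using z(3) by (auto simp: S)
  ultimately have eq: "S = z ` {..k}"
    using card_seteq[OF fin, of "z ` {..k}"] le by simp
  show "finite S" by fact
  show "card S = Suc k" using eq \<open>card (z ` {..k}) = Suc k\<close> by simp
  show "-1 \<in> S" using z(1) unfolding eq by force
  show "-1 \<le> t" if "t \<in> S" for t
    using that less z(1) unfolding eq by (metis atMost_iff imageE less_eq_real_def not_gr_zero)
qed

section \<open>The nodes and their Lagrange basis\<close>

context
  fixes N :: nat and \<tau> :: real
  assumes tau: "\<tau> > 0"
begin

text \<open>The substitution 2t/\<tau> - 1 is an increasing affine bijection, so the number of zeros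
  is kept and the least zero -1 becomes 0.\<close>

lemma shifted_legendre_roots:
  defines "T \<equiv> {t. poly (shifted_legendre \<tau> N + shifted_legendre \<tau> (N + 1)) t = 0}"
  shows "finite T" "card T = Suc N" "0 \<in> T" "\<And>t. t \<in> T \<Longrightarrow> 0 \<le> t"
proof -
  let ?S = "{t. poly (legendre N + legendre (Suc N)) t = 0}"
  let ?f = "\<lambda>x. \<tau> * (x + 1) / 2"
  have mem: "t \<in> T \<longleftrightarrow> 2 * t / \<tau> - 1 \<in> ?S" for t
    by (simp add: T_def shifted_legendre_def poly_pcompose algebra_simps)
  have eq: "T = ?f ` ?S"
  proof (intro equalityI subsetI)
    fix t assume "t \<in> T"
    then show "t \<in> ?f ` ?S" using tau mem by (intro image_eqI[of _ _ "2 * t / \<tau> - 1"]) auto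
  next
    fix t assume "t \<in> ?f ` ?S"
    then show "t \<in> T" using tau mem by force
  qed
  have "inj_on ?f ?S" using tau by (auto intro: inj_onI)
  then show "finite T" "card T = Suc N"
    unfolding eq using legendre_add_Suc_roots[of N] by (simp_all add: card_image)
  show "0 \<in> T" using legendre_add_Suc_roots(3)[of N] by (simp add: mem)
  show "0 \<le> t" if "t \<in> T" for t
    using that legendre_add_Suc_roots(4)[of _ N] tau unfolding eq by force
qed

text \<open>\<open>node\<close> indexes a sorted list without repetitions; the list has N + 1
  entries, so all indices up to N are within its range.\<close>

lemma inj_on_node: "inj_on (node N \<tau>) {..N}"
  using shifted_legendre_roots(1,2)
  by (intro inj_onI) (simp add: node_def nth_eq_iff_index_eq)

lemma node_0: "node N \<tau> 0 = 0"
proof -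
  define T where "T = {t. poly (shifted_legendre \<tau> N + shifted_legendre \<tau> (N + 1)) t = 0}"
  note T = shifted_legendre_roots[folded T_def]
  let ?xs = "sorted_list_of_set T"
  have len: "length ?xs = Suc N" using T(2) by simp
  have set: "set ?xs = T" using T(1) by simp
  from T(3) obtain i where i: "i < length ?xs" "?xs ! i = 0"
    using set by (metis in_set_conv_nth)
  then have "?xs ! 0 \<le> 0"
    using sorted_nth_mono[OF sorted_sorted_list_of_set, of 0 i T] by simp
  moreover have "0 \<le> ?xs ! 0"
    using T(4) set len by (metis nth_mem zero_less_Suc)
  ultimately show ?thesis by (simp add: node_def T_def)
qed

lemma node_eq_iff: "i \<le> N \<Longrightarrow> j \<le> N \<Longrightarrow> node N \<tau> i = node N \<tau> j \<longleftrightarrow> i = j"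
  using inj_on_node by (auto simp: inj_on_def)

lemma poly_lagrange_node:
  assumes "i \<le> N" "j \<le> N"
  shows "poly (lagrange N \<tau> i) (node N \<tau> j) = (if i = j then 1 else 0)"
proof (cases "i = j")
  case True
  have "1 / (node N \<tau> i - node N \<tau> h) * (node N \<tau> i - node N \<tau> h) = 1" if "h \<in> {0..N} - {i}" for h
    using that assms node_eq_iff by auto
  then show ?thesis
    unfolding lagrange_def poly_prod using True by (auto intro!: prod.neutral simp: diff_divide_distrib[symmetric])
next
  case False
  then have "j \<in> {0..N} - {i}" using assms by simp
  then have "(\<Prod>h\<in>{0..N} - {i}. poly (smult (1 / (node N \<tau> i - node N \<tau> h)) [:- node N \<tau> h, 1:]) (node N \<tau> j)) = 0"
    by (intro prod_zero) auto
  then show ?thesis using False by (simp only: lagrange_def poly_prod if_False)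
qed

lemma degree_lagrange:
  assumes "i \<le> N"
  shows "degree (lagrange N \<tau> i) \<le> N"
proof -
  have "degree (lagrange N \<tau> i)
      \<le> (\<Sum>j\<in>{0..N} - {i}. degree (smult (1 / (node N \<tau> i - node N \<tau> j)) [:- node N \<tau> j, 1:]))"
    unfolding lagrange_def by (rule order_trans[OF degree_prod_sum_le]) simp_all
  also have "\<dots> \<le> (\<Sum>j\<in>{0..N} - {i}. 1)"
    by (rule sum_mono) (simp add: degree_smult_eq)
  also have "\<dots> = N" using assms by simp
  finally show ?thesis .
qed

text \<open>The principle of collocation: an identity between polynomials of degree at most N may be
  checked at the N + 1 distinct nodes.\<close>

lemma poly_eq_if_nodes:
  assumes "degree p \<le> N" "degree q \<le> N"
    and "\<And>j. j \<le> N \<Longrightarrow> poly p (node N \<tau> j) = poly q (node N \<tau> j)"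
  shows "p = q"
proof (rule poly_eqI_degree[of "node N \<tau> ` {..N}"])
  show "degree p < card (node N \<tau> ` {..N})" "degree q < card (node N \<tau> ` {..N})"
    using assms inj_on_node by (simp_all add: card_image)
qed (use assms in auto)

end

subsection \<open>Vectorized matrix equations\<close>

text \<open>The index j * b + i is the column-major position of row i and column j, so sums over a
  stacked matrix become double sums.\<close>

lemma sum_lessThan_mult:
  "sum f {..<c * b} = (\<Sum>j<c. \<Sum>i<b. f (j * b + i))" for f :: "nat \<Rightarrow> real"
proof (induction c)
  case (Suc c)
  have "sum f {..<Suc c * b} = sum f {..<c * b} + sum f {c * b..<c * b + b}"
    by (simp add: lessThan_atLeast0 sum.atLeastLessThan_concat add.commute)
  also have "sum f {c * b..<c * b + b} = (\<Sum>i<b. f (c * b + i))"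
    using sum.shift_bounds_nat_ivl[of f 0 "c * b" b] by (simp add: lessThan_atLeast0 add.commute)
  finally show ?case using Suc by simp
qed simp

lemma index_lt_mult: "i < a \<Longrightarrow> j < b \<Longrightarrow> j * a + i < a * b" for a b i j :: nat
  using mult_le_mono2[of "Suc j" b a] by (simp add: mult.commute)

lemma stack_cols_carrier: "A \<in> carrier_mat nr nc \<Longrightarrow> stack_cols A \<in> carrier_vec (nr * nc)"
  by (simp add: stack_cols_def)

lemma stack_cols_index:
  "A \<in> carrier_mat nr nc \<Longrightarrow> i < nr \<Longrightarrow> j < nc \<Longrightarrow> stack_cols A $ (j * nr + i) = A $$ (i, j)"
  by (simp add: stack_cols_def index_lt_mult)

lemma stack_cols_eq_iff:
  assumes "A \<in> carrier_mat nr nc" "B \<in> carrier_mat nr nc"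
  shows "stack_cols A = stack_cols B \<longleftrightarrow> A = B"
proof
  assume eq: "stack_cols A = stack_cols B"
  show "A = B"
  proof (rule eq_matI)
    show "A $$ (i, j) = B $$ (i, j)" if "i < dim_row B" "j < dim_col B" for i j
      using assms that stack_cols_index[of A nr nc i j] stack_cols_index[of B nr nc i j] eq by simp
  qed (use assms in auto)
qed simp

lemma stack_cols_surj:
  assumes "v \<in> carrier_vec (nr * nc)"
  obtains A where "A \<in> carrier_mat nr nc" "stack_cols A = v"
proof
  let ?A = "mat nr nc (\<lambda>(i, j). v $ (j * nr + i))"
  show "?A \<in> carrier_mat nr nc" by simp
  show "stack_cols ?A = v"
  proof (rule eq_vecI)
    fix k assume "k < dim_vec v"
    then have k: "k < nr * nc" using assms by simp
    then have "0 < nr" by (cases nr) auto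
    then show "stack_cols ?A $ k = v $ k"
      using k by (simp add: stack_cols_def less_mult_imp_div_less mult.commute)
  qed (use assms in \<open>simp add: stack_cols_def\<close>)
qed

lemma stack_cols_add:
  "A \<in> carrier_mat nr nc \<Longrightarrow> B \<in> carrier_mat nr nc \<Longrightarrow> stack_cols (A + B) = stack_cols A + stack_cols B"
proof (rule eq_vecI)
  fix k assume "A \<in> carrier_mat nr nc" "B \<in> carrier_mat nr nc" "k < dim_vec (stack_cols A + stack_cols B)"
  moreover from this have "k < nc * nr" by (simp add: stack_cols_def mult.commute)
  moreover from this have "k mod nr < nr" "k div nr < nc"
    by (auto simp: less_mult_imp_div_less intro!: mod_less_divisor intro: gr0I)
  ultimately show "stack_cols (A + B) $ k = (stack_cols A + stack_cols B) $ k"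
    by (simp add: stack_cols_def mult.commute)
qed (simp add: stack_cols_def)

lemma kron_carrier:
  "A \<in> carrier_mat a b \<Longrightarrow> B \<in> carrier_mat c d \<Longrightarrow> A \<otimes>\<^sub>k B \<in> carrier_mat (a * c) (b * d)"
  by (simp add: kron_def)

text \<open>Position k of a stacked matrix is row k mod a and column k div a, which is also how
  \<open>kron\<close> splits its row index. The sum over the stacked entries of X then becomes the
  double sum of the triple product.\<close>

lemma kron_mult_stack_cols:
  assumes A: "A \<in> carrier_mat a b" and X: "X \<in> carrier_mat b c" and B: "B \<in> carrier_mat d c"
  shows "(B \<otimes>\<^sub>k A) *\<^sub>v stack_cols X = stack_cols (A * X * B\<^sup>T)"
proof (rule eq_vecI)
  fix k assume "k < dim_vec (stack_cols (A * X * B\<^sup>T))"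
  then have k: "k < d * a" using assms by (simp add: stack_cols_def mult.commute)
  then have a: "k mod a < a" and d: "k div a < d"
    by (auto simp: less_mult_imp_div_less intro!: mod_less_divisor intro: gr0I)
  have "((B \<otimes>\<^sub>k A) *\<^sub>v stack_cols X) $ k
      = (\<Sum>l<c * b. B $$ (k div a, l div b) * A $$ (k mod a, l mod b) * X $$ (l mod b, l div b))"
    using assms k
    by (simp add: kron_def stack_cols_def scalar_prod_def lessThan_atLeast0 mult.commute)
  also have "\<dots> = (\<Sum>j<c. \<Sum>i<b. B $$ (k div a, j) * A $$ (k mod a, i) * X $$ (i, j))"
    unfolding sum_lessThan_mult by (intro sum.cong refl) simp
  also have "\<dots> = (\<Sum>j<c. (\<Sum>i<b. A $$ (k mod a, i) * X $$ (i, j)) * B $$ (k div a, j))"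
    by (simp add: sum_distrib_left sum_distrib_right mult_ac)
  also have "\<dots> = (A * X * B\<^sup>T) $$ (k mod a, k div a)"
    using assms a d by (simp add: scalar_prod_def lessThan_atLeast0 del: assoc_mult_mat)
  finally show "((B \<otimes>\<^sub>k A) *\<^sub>v stack_cols X) $ k = stack_cols (A * X * B\<^sup>T) $ k"
    using assms k by (simp add: stack_cols_def mult.commute)
qed (use assms in \<open>simp add: kron_def stack_cols_def mult.commute\<close>)

lemma append_cols_carrier:
  "A \<in> carrier_mat nr nc1 \<Longrightarrow> B \<in> carrier_mat nr nc2 \<Longrightarrow> A @\<^sub>c B \<in> carrier_mat nr (nc1 + nc2)"
  unfolding append_cols_def using four_block_carrier_mat[of A nr nc1 "0\<^sub>m 0 (dim_col B)" 0 nc2] by simp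

lemma append_cols_mult:
  assumes "A \<in> carrier_mat nr nc1" "B \<in> carrier_mat nr nc2" "x \<in> carrier_vec nc1" "y \<in> carrier_vec nc2"
  shows "(A @\<^sub>c B) *\<^sub>v (x @\<^sub>v y) = A *\<^sub>v x + B *\<^sub>v y"
proof -
  \<comment> \<open>The lower blocks have no rows, so they contribute only vectors of dimension
    0.\<close>
  have "(A @\<^sub>c B) *\<^sub>v (x @\<^sub>v y)
      = (A *\<^sub>v x + B *\<^sub>v y) @\<^sub>v (0\<^sub>m 0 nc1 *\<^sub>v x + 0\<^sub>m 0 nc2 *\<^sub>v y)"
    unfolding append_cols_def using assms by (subst four_block_mat_mult_vec) auto
  also have "\<dots> = A *\<^sub>v x + B *\<^sub>v y"
    using assms by (intro eq_vecI) auto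
  finally show ?thesis .
qed

section \<open>Solvability of matrix equations and their vectorized form\<close>

lemma mult_unit_vec_eq_col:
  assumes "M \<in> carrier_mat r K" "j < K"
  shows "M *\<^sub>v unit_vec K j = (col M j :: real vec)"
  using assms by (intro eq_vecI) auto

lemma mat_minus_eq_iff:
  fixes A B C :: "real mat"
  assumes "A \<in> carrier_mat r K" "B \<in> carrier_mat r K" "C \<in> carrier_mat r K"
  shows "A - B = C \<longleftrightarrow> A = C + B"
proof
  assume "A - B = C"
  then show "A = C + B" using assms by (intro eq_matI) auto
next
  assume "A = C + B"
  then show "A - B = C" using assms by (intro eq_matI) auto
qed

text \<open>A matrix solution V gives w = V z. Conversely, the solutions for the unit vectors z are
  the columns of a matrix solution.\<close>

lemma matrix_equation_solvable_iff:
  fixes Q M :: "real mat"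
  assumes Q: "Q \<in> carrier_mat r q" and M: "M \<in> carrier_mat r K"
  shows "(\<exists>V\<in>carrier_mat q K. Q * V = M) \<longleftrightarrow>
    (\<forall>z\<in>carrier_vec K. \<exists>w\<in>carrier_vec q. Q *\<^sub>v w = M *\<^sub>v z)" (is "?L \<longleftrightarrow> ?R")
proof
  assume ?L
  then obtain V where V: "V \<in> carrier_mat q K" "Q * V = M" by auto
  show ?R
  proof
    fix z :: "real vec" assume "z \<in> carrier_vec K"
    then show "\<exists>w\<in>carrier_vec q. Q *\<^sub>v w = M *\<^sub>v z"
      using V Q by (intro bexI[of _ "V *\<^sub>v z"]) (auto simp flip: assoc_mult_mat_vec)
  qed
next
  assume R: ?R
  have "\<exists>w\<in>carrier_vec q. Q *\<^sub>v w = col M j" if "j < K" for j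
    using R[rule_format, of "unit_vec K j"] M that by (auto simp: mult_unit_vec_eq_col[OF M])
  then obtain w where w: "\<And>j. j < K \<Longrightarrow> w j \<in> carrier_vec q \<and> Q *\<^sub>v w j = col M j" by metis
  let ?V = "mat_of_cols q (map w [0..<K])"
  have "Q * ?V = M"
  proof (rule mat_col_eqI)
    fix j assume "j < dim_col M"
    then have j: "j < K" using M by simp
    have "col (Q * ?V) j = Q *\<^sub>v col ?V j" using Q j by (intro col_mult2[of _ r q _ K]) auto
    also have "col ?V j = w j" using w j by (subst col_mat_of_cols) auto
    finally show "col (Q * ?V) j = col M j" using w j by simp
  qed (use Q M in auto)
  then show ?L by (intro bexI[of _ ?V]) auto
qed

text \<open>Reading \<open>v1\<close> and \<open>v2\<close> as stacked matrices V and X turns the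
  system into Q V = R + T1 X T2. For fixed X this is a matrix equation in V, hence equivalent to
  solvability for every vector z.\<close>

lemma vectorized_equation_iff:
  assumes Q: "Q \<in> carrier_mat r q" and T1: "T1 \<in> carrier_mat r n" and T2: "T2 \<in> carrier_mat p K"
    and R: "R \<in> carrier_mat r K"
  shows "(\<exists>v1\<in>carrier_vec (q * K). \<exists>v2\<in>carrier_vec (n * p).
      ((1\<^sub>m K \<otimes>\<^sub>k Q) @\<^sub>c (- (T2\<^sup>T) \<otimes>\<^sub>k T1)) *\<^sub>v (v1 @\<^sub>v v2) = stack_cols R) \<longleftrightarrow>
    (\<exists>X\<in>carrier_mat n p. \<forall>z\<in>carrier_vec K. \<exists>w\<in>carrier_vec q.
      Q *\<^sub>v w = R *\<^sub>v z + T1 *\<^sub>v (X *\<^sub>v (T2 *\<^sub>v z)))"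
proof -
  have key: "((1\<^sub>m K \<otimes>\<^sub>k Q) @\<^sub>c (- (T2\<^sup>T) \<otimes>\<^sub>k T1)) *\<^sub>v (stack_cols V @\<^sub>v stack_cols X) = stack_cols R
      \<longleftrightarrow> Q * V = R + T1 * X * T2"
    if V: "V \<in> carrier_mat q K" and X: "X \<in> carrier_mat n p" for V X
  proof -
    have TX: "T1 * X * T2 \<in> carrier_mat r K" and QV: "Q * V \<in> carrier_mat r K"
      using Q T1 T2 V X by auto
    \<comment> \<open>The minus sign sits on the left Kronecker factor, whose transpose ends up on
      the right of X.\<close>
    have tr: "(- (T2\<^sup>T))\<^sup>T = - T2" using T2 by (intro eq_matI) auto
    have "((1\<^sub>m K \<otimes>\<^sub>k Q) @\<^sub>c (- (T2\<^sup>T) \<otimes>\<^sub>k T1)) *\<^sub>v (stack_cols V @\<^sub>v stack_cols X)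
        = (1\<^sub>m K \<otimes>\<^sub>k Q) *\<^sub>v stack_cols V + (- (T2\<^sup>T) \<otimes>\<^sub>k T1) *\<^sub>v stack_cols X"
    proof (rule append_cols_mult)
      show "1\<^sub>m K \<otimes>\<^sub>k Q \<in> carrier_mat (K * r) (K * q)" "- (T2\<^sup>T) \<otimes>\<^sub>k T1 \<in> carrier_mat (K * r) (p * n)"
        using Q T1 T2 by (auto intro: kron_carrier)
      show "stack_cols V \<in> carrier_vec (K * q)" "stack_cols X \<in> carrier_vec (p * n)"
        using stack_cols_carrier[OF V] stack_cols_carrier[OF X] by (simp_all add: mult.commute)
    qed
    also have "\<dots> = stack_cols (Q * V) + stack_cols (T1 * X * (- T2))"
      using kron_mult_stack_cols[OF Q V, of "1\<^sub>m K" K] kron_mult_stack_cols[OF T1 X, of "- (T2\<^sup>T)" K] T2 QV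
      by (simp add: tr right_mult_one_mat[OF QV])
    also have "\<dots> = stack_cols (Q * V - T1 * X * T2)"
      using TX QV T2 T1 X
      by (simp add: stack_cols_add[symmetric, of _ r K] minus_add_uminus_mat[of _ r K])
    also have "\<dots> = stack_cols R \<longleftrightarrow> Q * V - T1 * X * T2 = R"
      using TX R by (intro stack_cols_eq_iff minus_carrier_mat)
    also have "\<dots> \<longleftrightarrow> Q * V = R + T1 * X * T2"
      by (rule mat_minus_eq_iff[OF QV TX R])
    finally show ?thesis .
  qed
  have expand: "(R + T1 * X * T2) *\<^sub>v z = R *\<^sub>v z + T1 *\<^sub>v (X *\<^sub>v (T2 *\<^sub>v z))"
    if "X \<in> carrier_mat n p" "z \<in> carrier_vec K" for X z
  proof -
    have "(T1 * X * T2) *\<^sub>v z = T1 *\<^sub>v (X *\<^sub>v (T2 *\<^sub>v z))"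
      using that T1 T2 by (simp add: assoc_mult_mat_vec[of _ r n _ K] assoc_mult_mat_vec[of _ n p _ K])
    then show ?thesis
      using that R T1 T2 by (subst add_mult_distrib_mat_vec[of _ r K]) auto
  qed
  have "(\<exists>v1\<in>carrier_vec (q * K). \<exists>v2\<in>carrier_vec (n * p).
      ((1\<^sub>m K \<otimes>\<^sub>k Q) @\<^sub>c (- (T2\<^sup>T) \<otimes>\<^sub>k T1)) *\<^sub>v (v1 @\<^sub>v v2) = stack_cols R) \<longleftrightarrow>
    (\<exists>X\<in>carrier_mat n p. \<exists>V\<in>carrier_mat q K. Q * V = R + T1 * X * T2)" (is "?L \<longleftrightarrow> ?R")
  proof
    assume ?L
    then show ?R using key by (metis stack_cols_surj)
  next
    assume ?R
    then show ?L using key stack_cols_carrier by metis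
  qed
  also have "\<dots> \<longleftrightarrow> (\<exists>X\<in>carrier_mat n p. \<forall>z\<in>carrier_vec K. \<exists>w\<in>carrier_vec q.
      Q *\<^sub>v w = (R + T1 * X * T2) *\<^sub>v z)"
    using R T1 T2 by (intro bex_cong refl matrix_equation_solvable_iff[OF Q]) auto
  also have "\<dots> \<longleftrightarrow> (\<exists>X\<in>carrier_mat n p. \<forall>z\<in>carrier_vec K. \<exists>w\<in>carrier_vec q.
      Q *\<^sub>v w = R *\<^sub>v z + T1 *\<^sub>v (X *\<^sub>v (T2 *\<^sub>v z)))"
    using expand by simp
  finally show ?thesis .
qed

subsection \<open>The block system\<close>

text \<open>
  The columns of \<open>X\<close> and \<open>U\<close> are the values of state and input at the nodes \<open>t\<^sub>1, \<dots>, t\<^sub>N\<close>,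
  and \<open>y\<close> is the state at time \<open>\<tau>\<close>; the values at \<open>t\<^sub>0 = 0\<close> are \<open>x0\<close> and \<open>u0\<close>.
\<close>

definition collocation_eqs ::
  "nat \<Rightarrow> real \<Rightarrow> real mat \<Rightarrow> real mat \<Rightarrow> real vec \<Rightarrow> real vec \<Rightarrow> real vec \<Rightarrow> real vec \<Rightarrow> real mat \<Rightarrow> real mat \<Rightarrow> bool" where
  "collocation_eqs N \<tau> A B x0 u0 u1 y X U \<longleftrightarrow>
    X *\<^sub>v psi N \<tau> 0 = (A - poly (pderiv (lagrange N \<tau> 0)) 0 \<cdot>\<^sub>m 1\<^sub>m (dim_row A)) *\<^sub>v x0 + B *\<^sub>v u0 \<and>
    X * Psi N \<tau> - A * X - B * U = - (mat_of_cols (dim_row A) [x0] * sigma N \<tau>) \<and>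
    X *\<^sub>v Phi N \<tau> = - poly (lagrange N \<tau> 0) \<tau> \<cdot>\<^sub>v x0 + y \<and>
    U *\<^sub>v Phi N \<tau> = - poly (lagrange N \<tau> 0) \<tau> \<cdot>\<^sub>v u0 + u1"

lemma stack_cols_mat_of_cols: "v \<in> carrier_vec n \<Longrightarrow> stack_cols (mat_of_cols n [v]) = v"
  by (intro eq_vecI) (auto simp: stack_cols_def mat_of_cols_index)

text \<open>This is \<open>kron_mult_stack_cols\<close> for a one-row left factor, as in the blocks
  built from \<open>psi\<close> and \<open>Phi\<close>; stacking the resulting single column changes
  nothing.\<close>

lemma kron_row_mult_stack_cols:
  assumes "X \<in> carrier_mat n N" "p \<in> carrier_vec N"
  shows "(mat_of_row p \<otimes>\<^sub>k 1\<^sub>m n) *\<^sub>v stack_cols X = X *\<^sub>v p"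
proof -
  have "(mat_of_row p \<otimes>\<^sub>k 1\<^sub>m n) *\<^sub>v stack_cols X = stack_cols (1\<^sub>m n * X * (mat_of_row p)\<^sup>T)"
    using assms by (intro kron_mult_stack_cols) auto
  also have "1\<^sub>m n * X * (mat_of_row p)\<^sup>T = mat_of_cols n [X *\<^sub>v p]"
    using assms by (intro eq_matI) (auto simp: mat_of_cols_index)
  finally show ?thesis using assms by (simp add: stack_cols_mat_of_cols)
qed

lemma node_matrices_carrier:
  "psi N \<tau> j \<in> carrier_vec N" "Phi N \<tau> \<in> carrier_vec N"
  "Psi N \<tau> \<in> carrier_mat N N" "sigma N \<tau> \<in> carrier_mat 1 N"
  by (auto simp: psi_def Phi_def Psi_def sigma_def simp del: upt_Suc)

text \<open>The premises speak of dimensions instead of carriers, so that rewriting alone can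
  discharge them for nested blocks.\<close>

lemma mult_append_rows:
  fixes P R :: "real mat"
  assumes "dim_col P = dim_vec v" "dim_col R = dim_vec v"
  shows "(P @\<^sub>r R) *\<^sub>v v = P *\<^sub>v v @\<^sub>v R *\<^sub>v v"
  using assms by (intro mat_mult_append[of P "dim_row P" "dim_vec v" R "dim_row R"]) auto

lemma mult_append_cols:
  assumes "dim_row P = dim_row R" "dim_col P = dim_vec x" "dim_col R = dim_vec y"
  shows "(P @\<^sub>c R) *\<^sub>v (x @\<^sub>v y) = P *\<^sub>v x + R *\<^sub>v y"
  using assms by (intro append_cols_mult[of P "dim_row P" "dim_vec x" R "dim_vec y"]) auto

lemma dim_append_mat:
  "dim_row (P @\<^sub>r R) = dim_row P + dim_row R" "dim_col (P @\<^sub>r R) = dim_col P"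
  "dim_row (P @\<^sub>c R) = dim_row P" "dim_col (P @\<^sub>c R) = dim_col P + dim_col R"
  by (simp_all add: append_rows_def append_cols_def)

lemmas block_mult = mult_append_rows mult_append_cols dim_append_mat carrier_matD carrier_vecD
  index_append_vec(2) index_zero_mat(2,3) index_one_mat(2,3)

lemma smult_one_mat_mult:
  "v \<in> carrier_vec n \<Longrightarrow> (c \<cdot>\<^sub>m 1\<^sub>m n) *\<^sub>v v = (c :: real) \<cdot>\<^sub>v v"
  by (intro eq_vecI) auto

lemma zero_mat_mult: "v \<in> carrier_vec nc \<Longrightarrow> 0\<^sub>m nr nc *\<^sub>v v = (0\<^sub>v nr :: real vec)"
  by (intro eq_vecI) auto

lemma vec_split:
  fixes v :: "real vec"
  assumes "v \<in> carrier_vec (a + b)"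
  obtains x y where "x \<in> carrier_vec a" "y \<in> carrier_vec b" "v = x @\<^sub>v y"
  using assms vec_first_last_append[OF assms] vec_first_carrier vec_last_carrier by metis

lemma mat_split_cols:
  assumes "X \<in> carrier_mat n (a + b)"
  obtains Y Z where "Y \<in> carrier_mat n a" "Z \<in> carrier_mat n b" "X = Y @\<^sub>c Z"
proof
  let ?Y = "mat n a (\<lambda>(i, j). X $$ (i, j))" and ?Z = "mat n b (\<lambda>(i, j). X $$ (i, a + j))"
  show "X = ?Y @\<^sub>c ?Z" using assms by (intro eq_matI) (auto simp: append_cols_def)
qed auto

section \<open>Action of the block matrices on stacked unknowns\<close>

context
  fixes n m N :: nat and \<tau> :: real and A B :: "real mat"
  assumes A: "A \<in> carrier_mat n n" and B: "B \<in> carrier_mat n m"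
begin

lemma dims: "dim_row A = n" "dim_col B = m"
  using A B by auto

lemma Q_blocks_carrier:
  "mat_of_row (psi N \<tau> 0) \<otimes>\<^sub>k 1\<^sub>m n \<in> carrier_mat n (n * N)"
  "(Psi N \<tau>)\<^sup>T \<oplus>\<^sub>k (- A) \<in> carrier_mat (n * N) (n * N)"
  "- (1\<^sub>m N \<otimes>\<^sub>k B) \<in> carrier_mat (n * N) (m * N)"
  "mat_of_row (Phi N \<tau>) \<otimes>\<^sub>k 1\<^sub>m n \<in> carrier_mat n (n * N)"
  "mat_of_row (Phi N \<tau>) \<otimes>\<^sub>k 1\<^sub>m m \<in> carrier_mat m (m * N)"
  using A B node_matrices_carrier[of N \<tau>]
  by (auto simp: kron_def kron_sum_def mult.commute)

lemma Q_mat_carrier: "Q_mat N \<tau> A B \<in> carrier_mat (n + (n * N + (n + m))) (n * N + m * N)"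
  unfolding Q_mat_def Let_def dims
  by (intro carrier_append_rows append_cols_carrier Q_blocks_carrier zero_carrier_mat)

lemma R_blocks_carrier:
  "A - c \<cdot>\<^sub>m 1\<^sub>m n \<in> carrier_mat n n"
  "- ((sigma N \<tau>)\<^sup>T) \<otimes>\<^sub>k 1\<^sub>m n \<in> carrier_mat (n * N) n"
  "c \<cdot>\<^sub>m 1\<^sub>m k \<in> carrier_mat k k"
  using A B node_matrices_carrier[of N \<tau>] by (auto simp: kron_def mult.commute)

lemma R_mat_carrier: "R_mat N \<tau> A B \<in> carrier_mat (n + (n * N + (n + m))) (n + (m + m))"
  unfolding R_mat_def Let_def dims
  by (intro carrier_append_rows append_cols_carrier R_blocks_carrier B zero_carrier_mat one_carrier_mat)

lemma T1_mat_carrier: "T1_mat N n m \<in> carrier_mat (n + (n * N + (n + m))) n"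
  unfolding T1_mat_def by (intro carrier_append_rows zero_carrier_mat one_carrier_mat)

lemma T2_mat_carrier: "T2_mat n m \<in> carrier_mat (n + m) (n + (m + m))"
  unfolding T2_mat_def by (intro carrier_append_rows append_cols_carrier zero_carrier_mat one_carrier_mat)

text \<open>This block is a vectorized Sylvester operator: the Kronecker identity undoes the
  transpose on \<open>Psi\<close>, and the second summand multiplies by -A from the left.\<close>

lemma kron_sum_mult_stack_cols:
  assumes X: "X \<in> carrier_mat n N"
  shows "((Psi N \<tau>)\<^sup>T \<oplus>\<^sub>k (- A)) *\<^sub>v stack_cols X = stack_cols (X * Psi N \<tau> - A * X)"
proof -
  note P = node_matrices_carrier(3)[of N \<tau>]
  have "((Psi N \<tau>)\<^sup>T \<oplus>\<^sub>k (- A)) *\<^sub>v stack_cols X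
     = ((Psi N \<tau>)\<^sup>T \<otimes>\<^sub>k 1\<^sub>m n) *\<^sub>v stack_cols X + (1\<^sub>m N \<otimes>\<^sub>k (- A)) *\<^sub>v stack_cols X"
    unfolding kron_sum_def using A P X stack_cols_carrier[OF X]
    by (subst add_mult_distrib_mat_vec[of _ "N * n" "N * n"])
       (auto intro!: kron_carrier simp: mult.commute)
  also have "((Psi N \<tau>)\<^sup>T \<otimes>\<^sub>k 1\<^sub>m n) *\<^sub>v stack_cols X = stack_cols (X * Psi N \<tau>)"
    using kron_mult_stack_cols[OF one_carrier_mat X, of "(Psi N \<tau>)\<^sup>T" N] P X by simp
  also have "(1\<^sub>m N \<otimes>\<^sub>k (- A)) *\<^sub>v stack_cols X = stack_cols (- A * X)"
    using kron_mult_stack_cols[of "- A" n n X N "1\<^sub>m N" N] A X right_mult_one_mat[of "- A * X" n N]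
    by simp
  also have "stack_cols (X * Psi N \<tau>) + stack_cols (- A * X) = stack_cols (X * Psi N \<tau> - A * X)"
    using A X P by (subst stack_cols_add[of _ n N, symmetric]) 
      (auto simp: minus_add_uminus_mat[of "X * Psi N \<tau>" n N "A * X"])
  finally show ?thesis .
qed

lemma Q_mat_mult:
  assumes X: "X \<in> carrier_mat n N" and U: "U \<in> carrier_mat m N"
  shows "Q_mat N \<tau> A B *\<^sub>v (stack_cols X @\<^sub>v stack_cols U)
    = X *\<^sub>v psi N \<tau> 0 @\<^sub>v stack_cols (X * Psi N \<tau> - A * X - B * U) @\<^sub>v X *\<^sub>v Phi N \<tau> @\<^sub>v U *\<^sub>v Phi N \<tau>"
proof -
  note P = node_matrices_carrier(3)[of N \<tau>]
  note cX = stack_cols_carrier[OF X] and cU = stack_cols_carrier[OF U]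
  have "Q_mat N \<tau> A B *\<^sub>v (stack_cols X @\<^sub>v stack_cols U)
    = ((mat_of_row (psi N \<tau> 0) \<otimes>\<^sub>k 1\<^sub>m n) *\<^sub>v stack_cols X + 0\<^sub>m n (m * N) *\<^sub>v stack_cols U) @\<^sub>v
      (((Psi N \<tau>)\<^sup>T \<oplus>\<^sub>k (- A)) *\<^sub>v stack_cols X + (- (1\<^sub>m N \<otimes>\<^sub>k B)) *\<^sub>v stack_cols U) @\<^sub>v
      ((mat_of_row (Phi N \<tau>) \<otimes>\<^sub>k 1\<^sub>m n) *\<^sub>v stack_cols X + 0\<^sub>m n (m * N) *\<^sub>v stack_cols U) @\<^sub>v
      (0\<^sub>m m (n * N) *\<^sub>v stack_cols X + (mat_of_row (Phi N \<tau>) \<otimes>\<^sub>k 1\<^sub>m m) *\<^sub>v stack_cols U)"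
    unfolding Q_mat_def Let_def dims
    by (simp only: block_mult cX[THEN carrier_vecD] cU[THEN carrier_vecD] Q_blocks_carrier[THEN carrier_matD(1)]
      Q_blocks_carrier[THEN carrier_matD(2)])
  also have "((Psi N \<tau>)\<^sup>T \<oplus>\<^sub>k (- A)) *\<^sub>v stack_cols X + (- (1\<^sub>m N \<otimes>\<^sub>k B)) *\<^sub>v stack_cols U
      = stack_cols (X * Psi N \<tau> - A * X - B * U)"
  proof -
    have "(- (1\<^sub>m N \<otimes>\<^sub>k B)) *\<^sub>v stack_cols U = stack_cols (- (B * U))"
    proof -
      \<comment> \<open>The sign moves into the right factor, so that the Kronecker identity applies
        with -B.\<close>
      have "- (1\<^sub>m N \<otimes>\<^sub>k B) = 1\<^sub>m N \<otimes>\<^sub>k (- B)"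
        by (intro eq_matI) (auto simp: kron_def less_mult_imp_div_less intro!: index_uminus_mat(1)[symmetric] mod_less_divisor intro: gr0I)
      then show ?thesis
        using kron_mult_stack_cols[of "- B" n m U N "1\<^sub>m N" N] B U right_mult_one_mat[of "- B * U" n N]
        by simp
    qed
    then show ?thesis
      using A B X U P unfolding kron_sum_mult_stack_cols[OF X]
      by (subst minus_add_uminus_mat[of _ n N "B * U"], (auto)[2], subst stack_cols_add[of _ n N])
        (auto intro!: minus_carrier_mat)
  qed
  finally show ?thesis
    using A B X U node_matrices_carrier[of N \<tau>] cX cU
    by (simp add: kron_row_mult_stack_cols zero_mat_mult)
qed

lemma R_mat_mult:
  assumes x0: "x0 \<in> carrier_vec n" and u0: "u0 \<in> carrier_vec m" and u1: "u1 \<in> carrier_vec m"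
  shows "R_mat N \<tau> A B *\<^sub>v (x0 @\<^sub>v u0 @\<^sub>v u1)
    = ((A - poly (pderiv (lagrange N \<tau> 0)) 0 \<cdot>\<^sub>m 1\<^sub>m n) *\<^sub>v x0 + B *\<^sub>v u0) @\<^sub>v
      stack_cols (- (mat_of_cols n [x0] * sigma N \<tau>)) @\<^sub>v
      - poly (lagrange N \<tau> 0) \<tau> \<cdot>\<^sub>v x0 @\<^sub>v
      (- poly (lagrange N \<tau> 0) \<tau> \<cdot>\<^sub>v u0 + u1)"
proof -
  note S = node_matrices_carrier(4)[of N \<tau>]
  \<comment> \<open>The vector \<open>x0\<close> is regarded as a stacked one-column matrix, which
    makes the Kronecker identity applicable.\<close>
  have "(- ((sigma N \<tau>)\<^sup>T) \<otimes>\<^sub>k 1\<^sub>m n) *\<^sub>v x0 = (- ((sigma N \<tau>)\<^sup>T) \<otimes>\<^sub>k 1\<^sub>m n) *\<^sub>v stack_cols (mat_of_cols n [x0])"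
    by (simp only: stack_cols_mat_of_cols[OF x0])
  also have "\<dots> = stack_cols (1\<^sub>m n * mat_of_cols n [x0] * (- ((sigma N \<tau>)\<^sup>T))\<^sup>T)"
    using S by (intro kron_mult_stack_cols[where c = 1]) auto
  also have "1\<^sub>m n * mat_of_cols n [x0] * (- ((sigma N \<tau>)\<^sup>T))\<^sup>T = - (mat_of_cols n [x0] * sigma N \<tau>)"
    using S by (intro eq_matI) (auto simp: scalar_prod_def)
  finally have sig: "(- ((sigma N \<tau>)\<^sup>T) \<otimes>\<^sub>k 1\<^sub>m n) *\<^sub>v x0 = stack_cols (- (mat_of_cols n [x0] * sigma N \<tau>))" .
  have "R_mat N \<tau> A B *\<^sub>v (x0 @\<^sub>v u0 @\<^sub>v u1)
    = ((A - poly (pderiv (lagrange N \<tau> 0)) 0 \<cdot>\<^sub>m 1\<^sub>m n) *\<^sub>v x0 + (B *\<^sub>v u0 + 0\<^sub>m n m *\<^sub>v u1)) @\<^sub>v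
      ((- ((sigma N \<tau>)\<^sup>T) \<otimes>\<^sub>k 1\<^sub>m n) *\<^sub>v x0 + (0\<^sub>m (n * N) m *\<^sub>v u0 + 0\<^sub>m (n * N) m *\<^sub>v u1)) @\<^sub>v
      ((- poly (lagrange N \<tau> 0) \<tau> \<cdot>\<^sub>m 1\<^sub>m n) *\<^sub>v x0 + (0\<^sub>m n m *\<^sub>v u0 + 0\<^sub>m n m *\<^sub>v u1)) @\<^sub>v
      (0\<^sub>m m n *\<^sub>v x0 + ((- poly (lagrange N \<tau> 0) \<tau> \<cdot>\<^sub>m 1\<^sub>m m) *\<^sub>v u0 + 1\<^sub>m m *\<^sub>v u1))"
    unfolding R_mat_def Let_def dims
    by (simp only: block_mult x0[THEN carrier_vecD] u0[THEN carrier_vecD] u1[THEN carrier_vecD]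
      B[THEN carrier_matD(1)] B[THEN carrier_matD(2)] R_blocks_carrier[THEN carrier_matD(1)]
      R_blocks_carrier[THEN carrier_matD(2)])
  moreover have cS: "stack_cols (- (mat_of_cols n [x0] * sigma N \<tau>)) \<in> carrier_vec (n * N)"
    using S by (intro stack_cols_carrier uminus_carrier_mat mult_carrier_mat[of _ n 1]) auto
  ultimately show ?thesis
    using S B x0 u0 u1 cS
    by (simp add: sig zero_mat_mult smult_one_mat_mult)
qed

lemma T1_mat_mult:
  assumes "y \<in> carrier_vec n"
  shows "T1_mat N n m *\<^sub>v y = 0\<^sub>v n @\<^sub>v 0\<^sub>v (n * N) @\<^sub>v y @\<^sub>v 0\<^sub>v m"
  unfolding T1_mat_def using assms
  by (simp add: block_mult zero_mat_mult)

lemma T2_mat_mult: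
  assumes "x0 \<in> carrier_vec n" "u0 \<in> carrier_vec m" "u1 \<in> carrier_vec m"
  shows "T2_mat n m *\<^sub>v (x0 @\<^sub>v u0 @\<^sub>v u1) = x0 @\<^sub>v u0"
proof -
  have "T2_mat n m *\<^sub>v (x0 @\<^sub>v u0 @\<^sub>v u1)
     = (1\<^sub>m n *\<^sub>v x0 + (0\<^sub>m n m *\<^sub>v u0 + 0\<^sub>m n m *\<^sub>v u1)) @\<^sub>v (0\<^sub>m m n *\<^sub>v x0 + (1\<^sub>m m *\<^sub>v u0 + 0\<^sub>m m m *\<^sub>v u1))"
    unfolding T2_mat_def
    using assms by (simp add: block_mult)
  then show ?thesis using assms by (simp add: zero_mat_mult)
qed

text \<open>\<open>T1_mat\<close> places y in the third block only, so y enters just the equation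
  for the state at time \<tau>. The vectors are compared block by block, the second block through
  injectivity of stacking.\<close>

lemma block_equation_iff_collocation_eqs:
  assumes X: "X \<in> carrier_mat n N" and U: "U \<in> carrier_mat m N"
    and x0: "x0 \<in> carrier_vec n" and u0: "u0 \<in> carrier_vec m" and u1: "u1 \<in> carrier_vec m"
    and y: "y \<in> carrier_vec n"
  shows "Q_mat N \<tau> A B *\<^sub>v (stack_cols X @\<^sub>v stack_cols U)
      = R_mat N \<tau> A B *\<^sub>v (x0 @\<^sub>v u0 @\<^sub>v u1) + T1_mat N n m *\<^sub>v y
    \<longleftrightarrow> collocation_eqs N \<tau> A B x0 u0 u1 y X U"
proof -
  note C = node_matrices_carrier[of N \<tau>]
  define a where "a = (A - poly (pderiv (lagrange N \<tau> 0)) 0 \<cdot>\<^sub>m 1\<^sub>m n) *\<^sub>v x0 + B *\<^sub>v u0"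
  define S where "S = - (mat_of_cols n [x0] * sigma N \<tau>)"
  define b where "b = - poly (lagrange N \<tau> 0) \<tau> \<cdot>\<^sub>v x0"
  define d where "d = - poly (lagrange N \<tau> 0) \<tau> \<cdot>\<^sub>v u0 + u1"
  have ca: "a \<in> carrier_vec n" and cS: "S \<in> carrier_mat n N" and cb: "b \<in> carrier_vec n" and cd: "d \<in> carrier_vec m"
    using A B C x0 u0 u1 by (auto simp: a_def S_def b_def d_def intro!: add_carrier_vec mult_mat_vec_carrier)
  have cL: "X * Psi N \<tau> - A * X - B * U \<in> carrier_mat n N"
    using A B C X U by auto
  have "R_mat N \<tau> A B *\<^sub>v (x0 @\<^sub>v u0 @\<^sub>v u1) + T1_mat N n m *\<^sub>v y
      = (a @\<^sub>v stack_cols S @\<^sub>v b @\<^sub>v d) + (0\<^sub>v n @\<^sub>v 0\<^sub>v (n * N) @\<^sub>v y @\<^sub>v 0\<^sub>v m)"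
    unfolding R_mat_mult[OF x0 u0 u1] T1_mat_mult[OF y] a_def S_def b_def d_def ..
  also have "\<dots> = a @\<^sub>v stack_cols S @\<^sub>v (b + y) @\<^sub>v d"
    using ca cb cd y stack_cols_carrier[OF cS]
    by (simp add: append_vec_add[of _ n _ _ "n * N + (n + m)"] append_vec_add[of _ "n * N" _ _ "n + m"]
        append_vec_add[of _ n _ _ m])
  finally have "Q_mat N \<tau> A B *\<^sub>v (stack_cols X @\<^sub>v stack_cols U)
      = R_mat N \<tau> A B *\<^sub>v (x0 @\<^sub>v u0 @\<^sub>v u1) + T1_mat N n m *\<^sub>v y \<longleftrightarrow>
      X *\<^sub>v psi N \<tau> 0 @\<^sub>v stack_cols (X * Psi N \<tau> - A * X - B * U) @\<^sub>v X *\<^sub>v Phi N \<tau> @\<^sub>v U *\<^sub>v Phi N \<tau>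
      = a @\<^sub>v stack_cols S @\<^sub>v (b + y) @\<^sub>v d"
    unfolding Q_mat_mult[OF X U] by simp
  also have "\<dots> \<longleftrightarrow> X *\<^sub>v psi N \<tau> 0 = a \<and> stack_cols (X * Psi N \<tau> - A * X - B * U) = stack_cols S \<and>
      X *\<^sub>v Phi N \<tau> = b + y \<and> U *\<^sub>v Phi N \<tau> = d"
    using X U C ca cb y stack_cols_carrier[OF cS] stack_cols_carrier[OF cL]
    by (simp add: append_vec_eq[of _ n] append_vec_eq[of _ "n * N"])
  finally show ?thesis
    unfolding stack_cols_eq_iff[OF cL cS] unfolding collocation_eqs_def dims a_def S_def b_def d_def .
qed

text \<open>The unknown \<open>v2\<close> stacks the columns of [Ad Bd]. As \<open>T2_mat\<close>
  forgets \<open>u1\<close>, applying this matrix after it gives Ad x0 + Bd u0, the prescribed state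
  at time \<tau>. It remains to cut z into \<open>x0\<close>, \<open>u0\<close>, \<open>u1\<close>
  and w into the stacked \<open>X\<close> and \<open>U\<close>.\<close>

lemma vectorized_equation_iff_collocation:
  "(\<exists>v1\<in>carrier_vec ((n * N + m * N) * (n + 2 * m)). \<exists>v2\<in>carrier_vec (n * (n + m)).
       ((1\<^sub>m (n + 2 * m) \<otimes>\<^sub>k Q_mat N \<tau> A B) @\<^sub>c (- ((T2_mat n m)\<^sup>T) \<otimes>\<^sub>k T1_mat N n m))
         *\<^sub>v (v1 @\<^sub>v v2) = stack_cols (R_mat N \<tau> A B)) \<longleftrightarrow>
   (\<exists>Ad\<in>carrier_mat n n. \<exists>Bd\<in>carrier_mat n m.
     \<forall>x0\<in>carrier_vec n. \<forall>u0\<in>carrier_vec m. \<forall>u1\<in>carrier_vec m.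
     \<exists>X\<in>carrier_mat n N. \<exists>U\<in>carrier_mat m N.
       collocation_eqs N \<tau> A B x0 u0 u1 (Ad *\<^sub>v x0 + Bd *\<^sub>v u0) X U)" (is "?L \<longleftrightarrow> ?R")
proof -
  let ?eq = "\<lambda>w z y. Q_mat N \<tau> A B *\<^sub>v w = R_mat N \<tau> A B *\<^sub>v z + T1_mat N n m *\<^sub>v y"
  have K: "n + 2 * m = n + (m + m)" by simp
  have step: "(\<forall>z\<in>carrier_vec (n + (m + m)). \<exists>w\<in>carrier_vec (n * N + m * N).
        ?eq w z ((Ad @\<^sub>c Bd) *\<^sub>v (T2_mat n m *\<^sub>v z))) \<longleftrightarrow>
     (\<forall>x0\<in>carrier_vec n. \<forall>u0\<in>carrier_vec m. \<forall>u1\<in>carrier_vec m.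
       \<exists>X\<in>carrier_mat n N. \<exists>U\<in>carrier_mat m N.
       collocation_eqs N \<tau> A B x0 u0 u1 (Ad *\<^sub>v x0 + Bd *\<^sub>v u0) X U)" (is "?L2 \<longleftrightarrow> ?R2")
    if Ad: "Ad \<in> carrier_mat n n" and Bd: "Bd \<in> carrier_mat n m" for Ad Bd
  proof -
    have eq: "?eq (stack_cols X @\<^sub>v stack_cols U) (x0 @\<^sub>v u0 @\<^sub>v u1) ((Ad @\<^sub>c Bd) *\<^sub>v (T2_mat n m *\<^sub>v (x0 @\<^sub>v u0 @\<^sub>v u1)))
      \<longleftrightarrow> collocation_eqs N \<tau> A B x0 u0 u1 (Ad *\<^sub>v x0 + Bd *\<^sub>v u0) X U"
      if "x0 \<in> carrier_vec n" "u0 \<in> carrier_vec m" "u1 \<in> carrier_vec m" "X \<in> carrier_mat n N" "U \<in> carrier_mat m N"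
      for x0 u0 u1 X U
      unfolding T2_mat_mult[OF that(1-3)] append_cols_mult[OF Ad Bd that(1,2)]
      using that Ad Bd by (intro block_equation_iff_collocation_eqs) auto
    show ?thesis
    proof
      assume L: ?L2
      show ?R2
      proof (intro ballI)
        fix x0 u0 u1 :: "real vec"
        assume x: "x0 \<in> carrier_vec n" "u0 \<in> carrier_vec m" "u1 \<in> carrier_vec m"
        then have "x0 @\<^sub>v u0 @\<^sub>v u1 \<in> carrier_vec (n + (m + m))" by simp
        then obtain w where w: "w \<in> carrier_vec (n * N + m * N)"
          "?eq w (x0 @\<^sub>v u0 @\<^sub>v u1) ((Ad @\<^sub>c Bd) *\<^sub>v (T2_mat n m *\<^sub>v (x0 @\<^sub>v u0 @\<^sub>v u1)))"
          using L by blast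
        obtain xs us where xu: "xs \<in> carrier_vec (n * N)" "us \<in> carrier_vec (m * N)" "w = xs @\<^sub>v us"
          using vec_split[OF w(1)] .
        obtain X U where "X \<in> carrier_mat n N" "U \<in> carrier_mat m N" "stack_cols X = xs" "stack_cols U = us"
          using stack_cols_surj xu(1,2) by metis
        then show "\<exists>X\<in>carrier_mat n N. \<exists>U\<in>carrier_mat m N.
            collocation_eqs N \<tau> A B x0 u0 u1 (Ad *\<^sub>v x0 + Bd *\<^sub>v u0) X U"
          using eq[OF x] w(2) xu(3) by auto
      qed
    next
      assume R: ?R2
      show ?L2
      proof
        fix z :: "real vec"
        assume "z \<in> carrier_vec (n + (m + m))"
        then obtain x0 u0 u1 where x: "x0 \<in> carrier_vec n" "u0 \<in> carrier_vec m" "u1 \<in> carrier_vec m"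
          and z: "z = x0 @\<^sub>v u0 @\<^sub>v u1"
          by (metis vec_split)
        obtain X U where XU: "X \<in> carrier_mat n N" "U \<in> carrier_mat m N"
          "collocation_eqs N \<tau> A B x0 u0 u1 (Ad *\<^sub>v x0 + Bd *\<^sub>v u0) X U"
          using R x by blast
        then show "\<exists>w\<in>carrier_vec (n * N + m * N). ?eq w z ((Ad @\<^sub>c Bd) *\<^sub>v (T2_mat n m *\<^sub>v z))"
          using eq[OF x XU(1,2)] stack_cols_carrier z
          by (intro bexI[of _ "stack_cols X @\<^sub>v stack_cols U"]) auto
      qed
    qed
  qed
  have "?L \<longleftrightarrow> (\<exists>Y\<in>carrier_mat n (n + m). \<forall>z\<in>carrier_vec (n + (m + m)). \<exists>w\<in>carrier_vec (n * N + m * N).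
        ?eq w z (Y *\<^sub>v (T2_mat n m *\<^sub>v z)))"
    unfolding K by (rule vectorized_equation_iff[OF Q_mat_carrier T1_mat_carrier T2_mat_carrier R_mat_carrier])
  also have "\<dots> \<longleftrightarrow> (\<exists>Ad\<in>carrier_mat n n. \<exists>Bd\<in>carrier_mat n m.
      \<forall>z\<in>carrier_vec (n + (m + m)). \<exists>w\<in>carrier_vec (n * N + m * N).
        ?eq w z ((Ad @\<^sub>c Bd) *\<^sub>v (T2_mat n m *\<^sub>v z)))"
    (is "(\<exists>Y\<in>_. ?P Y) \<longleftrightarrow> _")
  proof
    assume "\<exists>Y\<in>carrier_mat n (n + m). ?P Y"
    then obtain Y where Y: "Y \<in> carrier_mat n (n + m)" "?P Y" by blast
    obtain Ad Bd where "Ad \<in> carrier_mat n n" "Bd \<in> carrier_mat n m" "Y = Ad @\<^sub>c Bd"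
      using mat_split_cols[OF Y(1)] .
    then show "\<exists>Ad\<in>carrier_mat n n. \<exists>Bd\<in>carrier_mat n m. ?P (Ad @\<^sub>c Bd)"
      using Y(2) by blast
  qed (blast intro: append_cols_carrier)
  also have "\<dots> \<longleftrightarrow> ?R"
    using step by (intro bex_cong refl)
  finally show ?thesis .
qed

end

subsection \<open>Collocation polynomials\<close>

text \<open>The differential equation is an identity of polynomials in each component, which is
  equivalent to its holding on a nondegenerate interval.\<close>

definition polynomial_step ::
  "nat \<Rightarrow> real \<Rightarrow> real mat \<Rightarrow> real mat \<Rightarrow> real vec \<Rightarrow> real vec \<Rightarrow> real vec \<Rightarrow> real vec \<Rightarrow>
    (nat \<Rightarrow> real poly) \<Rightarrow> (nat \<Rightarrow> real poly) \<Rightarrow> bool" where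
  "polynomial_step N \<tau> A B x0 u0 u1 y p q \<longleftrightarrow>
    (\<forall>k<dim_row A. degree (p k) \<le> N \<and> poly (p k) 0 = x0 $ k \<and> poly (p k) \<tau> = y $ k \<and>
       pderiv (p k) = (\<Sum>l<dim_row A. smult (A $$ (k, l)) (p l)) + (\<Sum>l<dim_col B. smult (B $$ (k, l)) (q l))) \<and>
    (\<forall>k<dim_col B. degree (q k) \<le> N \<and> poly (q k) 0 = u0 $ k \<and> poly (q k) \<tau> = u1 $ k)"

context
  fixes N :: nat and \<tau> :: real
  assumes tau: "\<tau> > 0"
begin

text \<open>The Lagrange interpolant, with the value \<open>c\<close> at the node 0 kept apart: that
  value is prescribed data, while \<open>v\<close> holds the unknowns at the other nodes.\<close>

definition node_interp :: "real \<Rightarrow> (nat \<Rightarrow> real) \<Rightarrow> real poly" where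
  "node_interp c v = smult c (lagrange N \<tau> 0) + (\<Sum>i<N. smult (v i) (lagrange N \<tau> (Suc i)))"

lemma node_interp_eq: "node_interp c v = (\<Sum>i\<le>N. smult (case i of 0 \<Rightarrow> c | Suc i \<Rightarrow> v i) (lagrange N \<tau> i))"
  unfolding node_interp_def lessThan_Suc_atMost[symmetric] sum.lessThan_Suc_shift by simp

lemma degree_node_interp: "degree (node_interp c v) \<le> N"
  unfolding node_interp_eq
  by (intro degree_sum_le) (auto intro: order_trans[OF degree_smult_le] degree_lagrange[OF tau])

lemma poly_node_interp_node:
  "j \<le> N \<Longrightarrow> poly (node_interp c v) (node N \<tau> j) = (case j of 0 \<Rightarrow> c | Suc i \<Rightarrow> v i)"
  unfolding node_interp_eq
  by (simp add: poly_sum poly_lagrange_node[OF tau] if_distrib cong: if_cong)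

lemma node_interp_unique:
  assumes "degree p \<le> N"
  shows "p = node_interp (poly p 0) (\<lambda>i. poly p (node N \<tau> (Suc i)))"
  by (rule poly_eq_if_nodes[OF tau assms degree_node_interp])
    (simp add: poly_node_interp_node node_0[OF tau] split: nat.split)

text \<open>The first equation is the differential equation at the node 0, the columns of the second
  are the equation at the other nodes, and the last two fix the values at \<tau>. Both sides of the
  differential equation have degree at most N, so the nodes decide it.\<close>

lemma collocation_eqs_iff_polynomial_step:
  assumes A: "A \<in> carrier_mat n n" and B: "B \<in> carrier_mat n m"
    and X: "X \<in> carrier_mat n N" and U: "U \<in> carrier_mat m N"
    and x0: "x0 \<in> carrier_vec n" and u0: "u0 \<in> carrier_vec m" and u1: "u1 \<in> carrier_vec m"
    and y: "y \<in> carrier_vec n"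
  shows "collocation_eqs N \<tau> A B x0 u0 u1 y X U \<longleftrightarrow>
    polynomial_step N \<tau> A B x0 u0 u1 y
      (\<lambda>k. node_interp (x0 $ k) (\<lambda>i. X $$ (k, i))) (\<lambda>k. node_interp (u0 $ k) (\<lambda>i. U $$ (k, i)))"
proof -
  define p where "p k = node_interp (x0 $ k) (\<lambda>i. X $$ (k, i))" for k
  define q where "q k = node_interp (u0 $ k) (\<lambda>i. U $$ (k, i))" for k
  define rhs where "rhs k = (\<Sum>l<n. smult (A $$ (k, l)) (p l)) + (\<Sum>l<m. smult (B $$ (k, l)) (q l))" for k
  have degp: "degree (p k) \<le> N" and degq: "degree (q k) \<le> N" for k
    by (simp_all add: p_def q_def degree_node_interp)
  have degr: "degree (rhs k) \<le> N" for k
    unfolding rhs_def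
    by (intro degree_add_le degree_sum_le) (auto intro: order_trans[OF degree_smult_le] degp degq)
  have p0: "poly (p k) 0 = x0 $ k" and q0: "poly (q k) 0 = u0 $ k" for k
    using poly_node_interp_node[of 0] by (simp_all add: p_def q_def node_0[OF tau])
  have pj: "poly (p k) (node N \<tau> (Suc j)) = X $$ (k, j)" and qj: "poly (q k) (node N \<tau> (Suc j)) = U $$ (k, j)"
    if "j < N" for j k
    using that by (simp_all add: p_def q_def poly_node_interp_node)
  have dp: "poly (pderiv (p k)) t = x0 $ k * poly (pderiv (lagrange N \<tau> 0)) t
      + (\<Sum>i<N. X $$ (k, i) * poly (pderiv (lagrange N \<tau> (Suc i))) t)" for k t
    by (simp add: p_def node_interp_def pderiv_add higher_pderiv_sum[of 1, simplified] pderiv_smult poly_sum)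
  have ptau: "poly (p k) \<tau> = x0 $ k * poly (lagrange N \<tau> 0) \<tau> + (\<Sum>i<N. X $$ (k, i) * poly (lagrange N \<tau> (Suc i)) \<tau>)"
    and qtau: "poly (q k) \<tau> = u0 $ k * poly (lagrange N \<tau> 0) \<tau> + (\<Sum>i<N. U $$ (k, i) * poly (lagrange N \<tau> (Suc i)) \<tau>)" for k
    by (simp_all add: p_def q_def node_interp_def poly_sum)
  \<comment> \<open>The contribution of the basis polynomial of index 0 moves to the right-hand
    side, where it is the multiple of the identity in \<open>R_mat\<close>.\<close>
  have e1: "X *\<^sub>v psi N \<tau> 0 = (A - poly (pderiv (lagrange N \<tau> 0)) 0 \<cdot>\<^sub>m 1\<^sub>m n) *\<^sub>v x0 + B *\<^sub>v u0
      \<longleftrightarrow> (\<forall>k<n. poly (pderiv (p k)) (node N \<tau> 0) = poly (rhs k) (node N \<tau> 0))"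
  proof -
    have "X *\<^sub>v psi N \<tau> 0 = (A - poly (pderiv (lagrange N \<tau> 0)) 0 \<cdot>\<^sub>m 1\<^sub>m n) *\<^sub>v x0 + B *\<^sub>v u0 \<longleftrightarrow>
      (\<forall>k<n. (X *\<^sub>v psi N \<tau> 0) $ k = ((A - poly (pderiv (lagrange N \<tau> 0)) 0 \<cdot>\<^sub>m 1\<^sub>m n) *\<^sub>v x0 + B *\<^sub>v u0) $ k)"
      using A B X by (auto simp: vec_eq_iff)
    also have "\<dots> \<longleftrightarrow> (\<forall>k<n. poly (pderiv (p k)) (node N \<tau> 0) = poly (rhs k) (node N \<tau> 0))"
    proof (intro all_cong)
      fix k assume k: "k < n"
      have "(X *\<^sub>v psi N \<tau> 0) $ k = (\<Sum>i<N. X $$ (k, i) * poly (pderiv (lagrange N \<tau> (Suc i))) 0)"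
        using X k by (simp add: psi_def scalar_prod_def lessThan_atLeast0 node_0[OF tau])
      moreover have "((A - poly (pderiv (lagrange N \<tau> 0)) 0 \<cdot>\<^sub>m 1\<^sub>m n) *\<^sub>v x0 + B *\<^sub>v u0) $ k
        = (\<Sum>l<n. A $$ (k, l) * x0 $ l) - poly (pderiv (lagrange N \<tau> 0)) 0 * x0 $ k + (\<Sum>l<m. B $$ (k, l) * u0 $ l)"
        using A B x0 u0 k
        by (simp add: scalar_prod_def lessThan_atLeast0 left_diff_distrib sum_subtractf if_distrib[of "\<lambda>x. _ * x * _"]
            if_distrib[of "\<lambda>x. x * _"] cong: if_cong)
      ultimately show "(X *\<^sub>v psi N \<tau> 0) $ k = ((A - poly (pderiv (lagrange N \<tau> 0)) 0 \<cdot>\<^sub>m 1\<^sub>m n) *\<^sub>v x0 + B *\<^sub>v u0) $ k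
        \<longleftrightarrow> poly (pderiv (p k)) (node N \<tau> 0) = poly (rhs k) (node N \<tau> 0)"
        by (auto simp: dp rhs_def poly_sum node_0[OF tau] p0 q0 mult.commute)
    qed
    finally show ?thesis .
  qed
  \<comment> \<open>Column j belongs to the node of index j + 1; \<open>sigma\<close> carries the
    contribution of \<open>x0\<close> to the derivative there.\<close>
  have e2: "X * Psi N \<tau> - A * X - B * U = - (mat_of_cols n [x0] * sigma N \<tau>)
      \<longleftrightarrow> (\<forall>k<n. \<forall>j<N. poly (pderiv (p k)) (node N \<tau> (Suc j)) = poly (rhs k) (node N \<tau> (Suc j)))"
  proof -
    have "X * Psi N \<tau> - A * X - B * U = - (mat_of_cols n [x0] * sigma N \<tau>) \<longleftrightarrow>
      (\<forall>k<n. \<forall>j<N. (X * Psi N \<tau> - A * X - B * U) $$ (k, j) = (- (mat_of_cols n [x0] * sigma N \<tau>)) $$ (k, j))"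
      using A B X U node_matrices_carrier[of N \<tau>] by (auto simp: mat_eq_iff)
    also have "\<dots> \<longleftrightarrow> (\<forall>k<n. \<forall>j<N. poly (pderiv (p k)) (node N \<tau> (Suc j)) = poly (rhs k) (node N \<tau> (Suc j)))"
    proof (intro all_cong)
      fix k j assume k: "k < n" and j: "j < N"
      have Psi: "Psi N \<tau> $$ (i, j) = poly (pderiv (lagrange N \<tau> (Suc i))) (node N \<tau> (Suc j))" if "i < N" for i
        using that j by (simp add: Psi_def mat_of_cols_index psi_def del: upt_Suc)
      have "(X * Psi N \<tau> - A * X - B * U) $$ (k, j)
        = (\<Sum>i<N. X $$ (k, i) * poly (pderiv (lagrange N \<tau> (Suc i))) (node N \<tau> (Suc j)))
          - (\<Sum>l<n. A $$ (k, l) * X $$ (l, j)) - (\<Sum>l<m. B $$ (k, l) * U $$ (l, j))"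
        using A B X U k j node_matrices_carrier[of N \<tau>] Psi by (simp add: scalar_prod_def lessThan_atLeast0)
      moreover have "(- (mat_of_cols n [x0] * sigma N \<tau>)) $$ (k, j)
        = - (x0 $ k * poly (pderiv (lagrange N \<tau> 0)) (node N \<tau> (Suc j)))"
        using k j by (simp add: scalar_prod_def sigma_def mat_of_cols_index)
      ultimately show "(X * Psi N \<tau> - A * X - B * U) $$ (k, j) = (- (mat_of_cols n [x0] * sigma N \<tau>)) $$ (k, j)
        \<longleftrightarrow> poly (pderiv (p k)) (node N \<tau> (Suc j)) = poly (rhs k) (node N \<tau> (Suc j))"
        using j by (auto simp: dp rhs_def poly_sum pj qj)
    qed
    finally show ?thesis .
  qed
  have e3: "X *\<^sub>v Phi N \<tau> = - poly (lagrange N \<tau> 0) \<tau> \<cdot>\<^sub>v x0 + y \<longleftrightarrow> (\<forall>k<n. poly (p k) \<tau> = y $ k)"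
    using X x0 y by (auto simp: vec_eq_iff Phi_def scalar_prod_def lessThan_atLeast0 ptau algebra_simps)
  have e4: "U *\<^sub>v Phi N \<tau> = - poly (lagrange N \<tau> 0) \<tau> \<cdot>\<^sub>v u0 + u1 \<longleftrightarrow> (\<forall>k<m. poly (q k) \<tau> = u1 $ k)"
    using U u0 u1 by (auto simp: vec_eq_iff Phi_def scalar_prod_def lessThan_atLeast0 qtau algebra_simps)
  have ode: "pderiv (p k) = rhs k \<longleftrightarrow> poly (pderiv (p k)) (node N \<tau> 0) = poly (rhs k) (node N \<tau> 0) \<and>
      (\<forall>j<N. poly (pderiv (p k)) (node N \<tau> (Suc j)) = poly (rhs k) (node N \<tau> (Suc j)))" (is "?L \<longleftrightarrow> ?R") for k
  proof
    assume R: ?R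
    show ?L
    proof (rule poly_eq_if_nodes[OF tau _ degr])
      show "degree (pderiv (p k)) \<le> N" using degp[of k] by (simp add: degree_pderiv)
      show "poly (pderiv (p k)) (node N \<tau> j) = poly (rhs k) (node N \<tau> j)" if "j \<le> N" for j
        using R that by (cases j) auto
    qed
  qed simp
  have dims: "dim_row A = n" "dim_col B = m" using A B by auto
  show ?thesis
    unfolding collocation_eqs_def polynomial_step_def dims p_def[symmetric] q_def[symmetric] rhs_def[symmetric]
      e1 e2 e3 e4 ode
    using degp degq p0 q0 by auto
qed

text \<open>Given polynomials are sampled at the nodes of index 1 to N; a polynomial of degree at
  most N is its own interpolant, so nothing is lost.\<close>

lemma collocation_solvable_iff_polynomial_step:
  assumes A: "A \<in> carrier_mat n n" and B: "B \<in> carrier_mat n m"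
    and x0: "x0 \<in> carrier_vec n" and u0: "u0 \<in> carrier_vec m" and u1: "u1 \<in> carrier_vec m"
    and y: "y \<in> carrier_vec n"
  shows "(\<exists>X\<in>carrier_mat n N. \<exists>U\<in>carrier_mat m N. collocation_eqs N \<tau> A B x0 u0 u1 y X U) \<longleftrightarrow>
    (\<exists>p q. polynomial_step N \<tau> A B x0 u0 u1 y p q)"
proof
  assume "\<exists>p q. polynomial_step N \<tau> A B x0 u0 u1 y p q"
  then obtain p q where pq: "polynomial_step N \<tau> A B x0 u0 u1 y p q" by blast
  have dims: "dim_row A = n" "dim_col B = m" using A B by auto
  define X where "X = mat n N (\<lambda>(k, i). poly (p k) (node N \<tau> (Suc i)))"
  define U where "U = mat m N (\<lambda>(k, i). poly (q k) (node N \<tau> (Suc i)))"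
  \<comment> \<open>Matrix entries in columns from N on are unspecified, so only the values with
    index below N may matter.\<close>
  have interp_cong: "node_interp c v = node_interp c w" if "\<And>i. i < N \<Longrightarrow> v i = w i" for c v w
    using that by (simp add: node_interp_def)
  have p: "node_interp (x0 $ k) (\<lambda>i. X $$ (k, i)) = p k" if "k < n" for k
  proof -
    have "degree (p k) \<le> N" "poly (p k) 0 = x0 $ k"
      using pq that by (simp_all add: polynomial_step_def dims)
    from node_interp_unique[OF this(1), unfolded this(2)] show ?thesis
      using that by (simp add: X_def cong: interp_cong)
  qed
  have q: "node_interp (u0 $ k) (\<lambda>i. U $$ (k, i)) = q k" if "k < m" for k
  proof -
    have "degree (q k) \<le> N" "poly (q k) 0 = u0 $ k"
      using pq that by (simp_all add: polynomial_step_def dims)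
    from node_interp_unique[OF this(1), unfolded this(2)] show ?thesis
      using that by (simp add: U_def cong: interp_cong)
  qed
  have "polynomial_step N \<tau> A B x0 u0 u1 y
      (\<lambda>k. node_interp (x0 $ k) (\<lambda>i. X $$ (k, i))) (\<lambda>k. node_interp (u0 $ k) (\<lambda>i. U $$ (k, i)))"
    using pq by (simp add: polynomial_step_def dims p q)
  then show "\<exists>X\<in>carrier_mat n N. \<exists>U\<in>carrier_mat m N. collocation_eqs N \<tau> A B x0 u0 u1 y X U"
    using collocation_eqs_iff_polynomial_step[OF A B _ _ x0 u0 u1 y, of X U]
    by (intro bexI[of _ X] bexI[of _ U]) (auto simp: X_def U_def)
qed (use collocation_eqs_iff_polynomial_step[OF A B _ _ x0 u0 u1 y] in blast)

end

subsection \<open>Piecewise polynomial solutions\<close>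

text \<open>The floor selects the right-hand piece at a breakpoint; the cap at l - 1 assigns the
  final time to the last piece.\<close>

definition glue :: "real \<Rightarrow> nat \<Rightarrow> (nat \<Rightarrow> real \<Rightarrow> 'a) \<Rightarrow> real \<Rightarrow> 'a" where
  "glue \<tau> l f t = (let i = min (nat \<lfloor>t / \<tau>\<rfloor>) (l - 1) in f i (t - real i * \<tau>))"

lemma glue_piece:
  assumes "\<tau> > 0" "i < l" "0 \<le> t" "t \<le> \<tau>"
    and "\<And>i. Suc i < l \<Longrightarrow> f i \<tau> = f (Suc i) 0"
  shows "glue \<tau> l f (real i * \<tau> + t) = f i t"
proof (cases "t = \<tau>")
  case False
  then have "\<lfloor>(real i * \<tau> + t) / \<tau>\<rfloor> = int i"
    using assms by (intro floor_unique) (simp_all add: field_simps)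
  then show ?thesis using assms by (simp add: glue_def)
next
  case True
  then have "(real i * \<tau> + t) / \<tau> = real (Suc i)" using assms by (simp add: field_simps)
  then have idx: "nat \<lfloor>(real i * \<tau> + t) / \<tau>\<rfloor> = Suc i" by (simp only: floor_of_nat nat_int)
  \<comment> \<open>At a right end point the floor already selects the next piece. The two pieces
    agree there by the matching hypothesis, and for the last piece the cap in \<open>glue\<close>
    restores the index i.\<close>
  show ?thesis
  proof (cases "Suc i < l")
    case True
    then have "min (Suc i) (l - 1) = Suc i" by simp
    then show ?thesis using assms(5)[OF True] \<open>t = \<tau>\<close> idx
      by (simp add: glue_def algebra_simps)
  next
    case False
    then have "min (Suc i) (l - 1) = i" using assms(2) by simp
    then show ?thesis using idx by (simp add: glue_def)
  qed
qed

text \<open>The complement of S is a neighbourhood of t that misses S. Derivatives within intervals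
  away from t thereby become vacuous.\<close>

lemma at_within_closed_eq_bot:
  fixes t :: real
  assumes "closed S" "t \<notin> S"
  shows "at t within S = bot"
  using assms by (auto simp: trivial_limit_def eventually_at_topological intro!: exI[of _ "- S"])

lemma has_real_derivative_within_Un:
  fixes f :: "real \<Rightarrow> real"
  assumes "(f has_real_derivative D) (at t within S)" "(f has_real_derivative D) (at t within T)"
  shows "(f has_real_derivative D) (at t within S \<union> T)"
  using assms unfolding has_field_derivative_iff by (simp only: at_within_union filterlim_sup)

text \<open>Induction appends one touching interval at a time. At a breakpoint both one-sided
  derivatives have the same value D, and intervals not containing t impose nothing.\<close>

lemma has_real_derivative_pieces:
  fixes h :: "real \<Rightarrow> real"
  assumes "\<tau> > 0" "\<And>i. i < l \<Longrightarrow> t \<in> {real i * \<tau>..real (i + 1) * \<tau>} \<Longrightarrow>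
      (h has_real_derivative D) (at t within {real i * \<tau>..real (i + 1) * \<tau>})"
    and "0 < l"
  shows "(h has_real_derivative D) (at t within {0..real l * \<tau>})"
  using \<open>0 < l\<close> assms(2)
proof (induction l rule: nat_induct_non_zero)
  case 1
  show ?case
  proof (cases "t \<in> {0..\<tau>}")
    case True
    then show ?thesis using 1[of 0] by simp
  next
    case False
    then show ?thesis by (simp add: at_within_closed_eq_bot has_field_derivative_iff)
  qed
next
  case (Suc l)
  have "{0..real (Suc l) * \<tau>} = {0..real l * \<tau>} \<union> {real l * \<tau>..real (l + 1) * \<tau>}"
    using ivl_disj_un_two_touch(4)[of 0 "real l * \<tau>" "real (l + 1) * \<tau>"] \<open>\<tau> > 0\<close> by simp
  moreover have "(h has_real_derivative D) (at t within {real l * \<tau>..real (l + 1) * \<tau>})"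
  proof (cases "t \<in> {real l * \<tau>..real (l + 1) * \<tau>}")
    case False
    then have "at t within {real l * \<tau>..real (l + 1) * \<tau>} = bot"
      by (intro at_within_closed_eq_bot closed_atLeastAtMost)
    then show ?thesis unfolding has_field_derivative_iff by (simp only: tendsto_bot)
  qed (use Suc.prems in simp)
  moreover have "(h has_real_derivative D) (at t within {0..real l * \<tau>})"
    by (rule Suc.IH) (use Suc.prems in simp)
  ultimately show ?case by (simp only: has_real_derivative_within_Un)
qed

lemma glue_interpolation:
  assumes "\<tau> > 0"
    and "\<And>i. i < l \<Longrightarrow> f i \<in> vec_polys N p"
    and f0: "\<And>i. i < l \<Longrightarrow> f i 0 = s i" and f1: "\<And>i. i < l \<Longrightarrow> f i \<tau> = s (Suc i)"
  shows "glue \<tau> l f \<in> interpolations N \<tau> p l s"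
proof -
  have piece: "glue \<tau> l f (real i * \<tau> + t) = f i t" if "i < l" "0 \<le> t" "t \<le> \<tau>" for i t
    using that assms by (intro glue_piece) auto
  have "glue \<tau> l f (real i * \<tau>) = s i \<and> glue \<tau> l f (real (i + 1) * \<tau>) = s (i + 1)" if "i < l" for i
    using piece[of i 0] piece[of i \<tau>] that assms by (simp add: algebra_simps)
  then show ?thesis
    unfolding interpolations_def using assms piece by auto
qed

lemma index_mult_mat_vec_sum:
  "k < dim_row A \<Longrightarrow> v \<in> carrier_vec (dim_col A) \<Longrightarrow> (A *\<^sub>v v) $ k = (\<Sum>l<dim_col A. A $$ (k, l) * v $ l)"
  for A :: "real mat"
  by (simp add: scalar_prod_def lessThan_atLeast0)

lemma dt_solution_carrier:
  assumes "Ad \<in> carrier_mat n n" "Bd \<in> carrier_mat n m" "x0 \<in> carrier_vec n"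
  shows "(\<And>j. j < i \<Longrightarrow> u j \<in> carrier_vec m) \<Longrightarrow> dt_solution Ad Bd x0 u i \<in> carrier_vec n"
  using assms by (induction i) auto

text \<open>Otherwise the difference would be a nonzero polynomial with infinitely many
  roots.\<close>

lemma poly_eq_if_eq_on_interval:
  fixes p q :: "real poly"
  assumes "a < b" "\<And>t. a < t \<Longrightarrow> t < b \<Longrightarrow> poly p t = poly q t"
  shows "p = q"
proof (rule ccontr)
  assume "p \<noteq> q"
  then have "finite {t. poly (p - q) t = 0}" by (intro poly_roots_finite) simp
  moreover have "{a<..<b} \<subseteq> {t. poly (p - q) t = 0}" using assms by auto
  ultimately show False using assms(1) by (meson finite_subset infinite_Ioo)
qed

section \<open>Reduction of the interpolator property to single steps\<close>

context
  fixes N n m :: nat and \<tau> :: real and A B Ad Bd :: "real mat"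
  assumes tau: "\<tau> > 0"
    and A: "A \<in> carrier_mat n n" and B: "B \<in> carrier_mat n m"
    and Ad: "Ad \<in> carrier_mat n n" and Bd: "Bd \<in> carrier_mat n m"
begin

text \<open>The case l = 1 is enough, since both end values of the input may be prescribed
  freely.\<close>

lemma polynomial_step_if_system_interpolator:
  assumes "system_interpolator N \<tau> A B Ad Bd"
    and x0: "x0 \<in> carrier_vec n" and u0: "u0 \<in> carrier_vec m" and u1: "u1 \<in> carrier_vec m"
  shows "\<exists>p q. polynomial_step N \<tau> A B x0 u0 u1 (Ad *\<^sub>v x0 + Bd *\<^sub>v u0) p q"
proof -
  have dims: "dim_row A = n" "dim_col A = n" "dim_row B = n" "dim_col B = m" using A B by auto
  define ud where "ud i = (if i = 0 then u0 else u1)" for i :: nat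
  have "\<forall>i\<le>1. ud i \<in> carrier_vec m" using u0 u1 by (simp add: ud_def)
  then obtain uc xc where uc: "uc \<in> interpolations N \<tau> m 1 ud"
    and sol: "ct_solution A B (real 1 * \<tau>) x0 uc xc"
    and xc: "xc \<in> interpolations N \<tau> n 1 (dt_solution Ad Bd x0 ud)"
    using assms(1) x0 unfolding system_interpolator_def Let_def dims
    by (metis less_numeral_extra(1))
  from uc obtain Pu where Pu: "Pu \<in> vec_polys N m" "uc 0 = u0" "uc \<tau> = u1" "\<And>t. t \<in> {0..\<tau>} \<Longrightarrow> uc t = Pu t"
    by (auto simp: interpolations_def ud_def)
  from xc obtain Px where Px: "Px \<in> vec_polys N n" "xc 0 = x0" "xc \<tau> = Ad *\<^sub>v x0 + Bd *\<^sub>v u0"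
    "\<And>t. t \<in> {0..\<tau>} \<Longrightarrow> xc t = Px t"
    by (auto simp: interpolations_def ud_def)
  from Pu(1) obtain q where q: "\<And>k. k < m \<Longrightarrow> degree (q k) \<le> N" "\<And>t. Pu t = vec m (\<lambda>k. poly (q k) t)"
    by (auto simp: vec_polys_def)
  from Px(1) obtain p where p: "\<And>k. k < n \<Longrightarrow> degree (p k) \<le> N" "\<And>t. Px t = vec n (\<lambda>k. poly (p k) t)"
    by (auto simp: vec_polys_def)
  have x: "xc t $ k = poly (p k) t" if "t \<in> {0..\<tau>}" "k < n" for t k
    using Px(4) p(2) that by simp
  have u: "uc t $ k = poly (q k) t" if "t \<in> {0..\<tau>}" "k < m" for t k
    using Pu(4) q(2) that by simp
  have ode: "pderiv (p k) = (\<Sum>l<n. smult (A $$ (k, l)) (p l)) + (\<Sum>l<m. smult (B $$ (k, l)) (q l))"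
    if k: "k < n" for k
  proof (rule poly_eq_if_eq_on_interval[OF tau])
    fix t assume t: "0 < t" "t < \<tau>"
    then have t': "t \<in> {0..\<tau>}" by simp
    \<comment> \<open>Interior points suffice for an identity of polynomials, and there the
      derivative is two-sided, hence unique.\<close>
    have at: "at t within {0..\<tau>} = at t" using t by (rule at_within_Icc_at)
    have "(poly (p k) has_real_derivative poly (pderiv (p k)) t) (at t within {0..\<tau>})"
      by (rule has_field_derivative_at_within[OF poly_DERIV])
    then have "((\<lambda>s. xc s $ k) has_real_derivative poly (pderiv (p k)) t) (at t within {0..\<tau>})"
      by (rule has_field_derivative_transform_within[where d = 1]) (use x k t' in auto)
    moreover have "((\<lambda>s. xc s $ k) has_real_derivative (A *\<^sub>v xc t + B *\<^sub>v uc t) $ k) (at t within {0..\<tau>})"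
      using sol t' k by (simp add: ct_solution_def dims)
    ultimately have "poly (pderiv (p k)) t = (A *\<^sub>v xc t + B *\<^sub>v uc t) $ k"
      unfolding at by (rule DERIV_unique)
    also have "\<dots> = (\<Sum>l<n. A $$ (k, l) * xc t $ l) + (\<Sum>l<m. B $$ (k, l) * uc t $ l)"
      using k Px(4)[OF t'] Pu(4)[OF t'] p(2) q(2)
      by (simp add: index_mult_mat_vec_sum dims del: index_mult_mat_vec)
    also have "\<dots> = poly ((\<Sum>l<n. smult (A $$ (k, l)) (p l)) + (\<Sum>l<m. smult (B $$ (k, l)) (q l))) t"
      using x[OF t'] u[OF t'] by (simp add: poly_sum)
    finally show "poly (pderiv (p k)) t = \<dots>" .
  qed
  have "polynomial_step N \<tau> A B x0 u0 u1 (Ad *\<^sub>v x0 + Bd *\<^sub>v u0) p q"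
    unfolding polynomial_step_def dims
    using p(1) q(1) ode x[of 0] x[of \<tau>] u[of 0] u[of \<tau>] Px(2,3) Pu(2,3) tau by auto
  then show ?thesis by blast
qed

text \<open>Each step ends with the state \<open>xd (Suc i)\<close> and the input
  \<open>ud (Suc i)\<close>, which are the initial data of the next one. The pieces therefore match
  and can be glued.\<close>

lemma system_interpolator_if_polynomial_step:
  assumes step: "\<And>x0 u0 u1. x0 \<in> carrier_vec n \<Longrightarrow> u0 \<in> carrier_vec m \<Longrightarrow> u1 \<in> carrier_vec m \<Longrightarrow>
    \<exists>p q. polynomial_step N \<tau> A B x0 u0 u1 (Ad *\<^sub>v x0 + Bd *\<^sub>v u0) p q"
  shows "system_interpolator N \<tau> A B Ad Bd"
proof -
  have dims: "dim_row A = n" "dim_col A = n" "dim_row B = n" "dim_col B = m" using A B by auto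
  have "\<exists>uc\<in>interpolations N \<tau> m l ud. \<exists>xc. ct_solution A B (real l * \<tau>) x0 uc xc \<and>
      xc \<in> interpolations N \<tau> n l (dt_solution Ad Bd x0 ud)"
    if l: "0 < l" and x0: "x0 \<in> carrier_vec n" and ud: "\<forall>i\<le>l. ud i \<in> carrier_vec m" for l x0 ud
  proof -
    define xd where "xd = dt_solution Ad Bd x0 ud"
    have xd: "xd i \<in> carrier_vec n" if "i \<le> l" for i
      unfolding xd_def using ud that by (intro dt_solution_carrier[OF Ad Bd x0]) auto
    have "\<exists>p q. polynomial_step N \<tau> A B (xd i) (ud i) (ud (Suc i)) (xd (Suc i)) p q" if "i < l" for i
      using step[of "xd i" "ud i" "ud (Suc i)"] xd ud that by (simp add: xd_def)
    then obtain p q where pq: "\<And>i. i < l \<Longrightarrow>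
        polynomial_step N \<tau> A B (xd i) (ud i) (ud (Suc i)) (xd (Suc i)) (p i) (q i)"
      by metis
    define fx where "fx i t = vec n (\<lambda>k. poly (p i k) t)" for i t
    define fu where "fu i t = vec m (\<lambda>k. poly (q i k) t)" for i t
    define xc where "xc = glue \<tau> l fx"
    define uc where "uc = glue \<tau> l fu"
    have fx: "fx i \<in> vec_polys N n" "fx i 0 = xd i" "fx i \<tau> = xd (Suc i)" if "i < l" for i
      using pq[OF that] xd[of i] xd[of "Suc i"] that
      by (auto simp: fx_def vec_polys_def polynomial_step_def dims)
    have fu: "fu i \<in> vec_polys N m" "fu i 0 = ud i" "fu i \<tau> = ud (Suc i)" if "i < l" for i
      using pq[OF that] ud[rule_format, of i] ud[rule_format, of "Suc i"] that
      by (auto simp: fu_def vec_polys_def polynomial_step_def dims)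
    have xpiece: "xc (real i * \<tau> + t) = fx i t" and upiece: "uc (real i * \<tau> + t) = fu i t"
      if "i < l" "0 \<le> t" "t \<le> \<tau>" for i t
      unfolding xc_def uc_def using that tau fx fu by (auto intro!: glue_piece)
    have "xc \<in> interpolations N \<tau> n l xd"
      unfolding xc_def using fx by (intro glue_interpolation[OF tau])
    moreover have "uc \<in> interpolations N \<tau> m l ud"
      unfolding uc_def using fu by (intro glue_interpolation[OF tau])
    moreover have "ct_solution A B (real l * \<tau>) x0 uc xc"
      unfolding ct_solution_def dims
    proof (intro conjI ballI allI impI)
      show "xc 0 = x0" using xpiece[of 0 0] fx(2)[OF l] l tau by (simp add: xd_def)
      fix t assume t: "t \<in> {0..real l * \<tau>}"
      show "xc t \<in> carrier_vec n" by (simp add: xc_def glue_def fx_def Let_def)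
      fix k assume k: "k < n"
      show "((\<lambda>s. xc s $ k) has_real_derivative (A *\<^sub>v xc t + B *\<^sub>v uc t) $ k) (at t within {0..real l * \<tau>})"
      proof (rule has_real_derivative_pieces[OF tau _ l])
        fix i assume i: "i < l" and ti: "t \<in> {real i * \<tau>..real (i + 1) * \<tau>}"
        define r where "r = t - real i * \<tau>"
        have r: "0 \<le> r" "r \<le> \<tau>" "t = real i * \<tau> + r" using ti by (auto simp: r_def algebra_simps)
        have "((\<lambda>s. poly (p i k) (s - real i * \<tau>)) has_real_derivative poly (pderiv (p i k)) r * 1)
            (at t within {real i * \<tau>..real (i + 1) * \<tau>})"
          unfolding r_def
          by (rule DERIV_chain2[OF poly_DERIV]) (auto intro!: derivative_eq_intros)
        then have deriv: "((\<lambda>s. poly (p i k) (s - real i * \<tau>)) has_real_derivative poly (pderiv (p i k)) r)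
            (at t within {real i * \<tau>..real (i + 1) * \<tau>})"
          by simp
        have xs: "xc s $ k = poly (p i k) (s - real i * \<tau>)" if "s \<in> {real i * \<tau>..real (i + 1) * \<tau>}" for s
          using xpiece[of i "s - real i * \<tau>"] i k that by (simp add: fx_def algebra_simps)
        \<comment> \<open>At a breakpoint this holds for both adjacent pieces with the same
          left-hand side, so the one-sided derivatives agree.\<close>
        have "(A *\<^sub>v xc t + B *\<^sub>v uc t) $ k = poly (pderiv (p i k)) r"
        proof -
          have "(A *\<^sub>v xc t + B *\<^sub>v uc t) $ k = (\<Sum>l<n. A $$ (k, l) * fx i r $ l) + (\<Sum>l<m. B $$ (k, l) * fu i r $ l)"
            unfolding r(3) xpiece[OF i r(1,2)] upiece[OF i r(1,2)] using k
            by (simp add: index_mult_mat_vec_sum dims fx_def fu_def del: index_mult_mat_vec)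
          also have "\<dots> = poly (pderiv (p i k)) r"
            using pq[OF i] k by (simp add: polynomial_step_def dims poly_sum fx_def fu_def)
          finally show ?thesis .
        qed
        with deriv xs ti show "((\<lambda>s. xc s $ k) has_real_derivative (A *\<^sub>v xc t + B *\<^sub>v uc t) $ k)
            (at t within {real i * \<tau>..real (i + 1) * \<tau>})"
          by (simp only:) (rule has_field_derivative_transform_within[where d = 1], auto)
      qed
    qed
    ultimately show ?thesis unfolding xd_def by blast
  qed
  then show ?thesis unfolding system_interpolator_def Let_def dims by blast
qed

end

theorem theorem3:
  fixes Ac Bc :: "real mat" and n m N :: nat and \<tau> :: real
  assumes "n > 0" and "m > 0"
    and "Ac \<in> carrier_mat n n" and "Bc \<in> carrier_mat n m"
    and "\<tau> > 0" and "N \<ge> 1"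
  shows "(\<exists>Ad\<in>carrier_mat n n. \<exists>Bd\<in>carrier_mat n m. system_interpolator N \<tau> Ac Bc Ad Bd) \<longleftrightarrow>
    (\<exists>v1\<in>carrier_vec ((n * N + m * N) * (n + 2 * m)). \<exists>v2\<in>carrier_vec (n * (n + m)).
       ((1\<^sub>m (n + 2 * m) \<otimes>\<^sub>k Q_mat N \<tau> Ac Bc) @\<^sub>c (- ((T2_mat n m)\<^sup>T) \<otimes>\<^sub>k T1_mat N n m))
         *\<^sub>v (v1 @\<^sub>v v2) = stack_cols (R_mat N \<tau> Ac Bc))"
proof -
  \<comment> \<open>For a fixed pair Ad, Bd both conditions say that polynomial steps exist for all
    data \<open>x0\<close>, \<open>u0\<close>, \<open>u1\<close>; the quantifiers over the pair are
    added at the end.\<close>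
  have "system_interpolator N \<tau> Ac Bc Ad Bd \<longleftrightarrow>
     (\<forall>x0\<in>carrier_vec n. \<forall>u0\<in>carrier_vec m. \<forall>u1\<in>carrier_vec m.
     \<exists>X\<in>carrier_mat n N. \<exists>U\<in>carrier_mat m N.
       collocation_eqs N \<tau> Ac Bc x0 u0 u1 (Ad *\<^sub>v x0 + Bd *\<^sub>v u0) X U)" (is "_ \<longleftrightarrow> ?R")
    if AB: "Ad \<in> carrier_mat n n" "Bd \<in> carrier_mat n m" for Ad Bd
  proof -
    have "?R \<longleftrightarrow> (\<forall>x0\<in>carrier_vec n. \<forall>u0\<in>carrier_vec m. \<forall>u1\<in>carrier_vec m.
        \<exists>p q. polynomial_step N \<tau> Ac Bc x0 u0 u1 (Ad *\<^sub>v x0 + Bd *\<^sub>v u0) p q)"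
      using assms AB
      by (intro ball_cong refl collocation_solvable_iff_polynomial_step[of \<tau> Ac n Bc m]) auto
    also have "\<dots> \<longleftrightarrow> system_interpolator N \<tau> Ac Bc Ad Bd"
    proof
      assume "system_interpolator N \<tau> Ac Bc Ad Bd"
      then show "\<forall>x0\<in>carrier_vec n. \<forall>u0\<in>carrier_vec m. \<forall>u1\<in>carrier_vec m.
        \<exists>p q. polynomial_step N \<tau> Ac Bc x0 u0 u1 (Ad *\<^sub>v x0 + Bd *\<^sub>v u0) p q"
        using polynomial_step_if_system_interpolator[OF \<open>\<tau> > 0\<close> assms(3,4) AB] by blast
    qed (rule system_interpolator_if_polynomial_step[OF \<open>\<tau> > 0\<close> assms(3,4) AB], blast)
    finally show ?thesis ..
  qed
  then show ?thesis
    unfolding vectorized_equation_iff_collocation[OF assms(3,4)]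
    by (intro bex_cong refl)
qed

end
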